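(* Let $f,r,\mathrm{B},\mathrm{D},\mathrm{d}$ and $F,R,\mathbf{D},\mathbf{d},\mathcal{L},\mathcal{W}^*$ be as in the context, let $\mathbf{J}=\mathbf{Q}-\alpha\mathbf{D}\mathbf{D}^{\top}$, and let $\{\mathbf{X}^k,\bar{\mathbf{X}}^k,\mathbf{\Lambda}^k\}_{k\ge0}$ be generated from an arbitrary $\mathbf{X}^0\in\mathcal{X}$ and $\mathbf{\Lambda}^0=0$ by \begin{align*} \bar{\mathbf{X}}^{k}&=\mathrm{prox}^{\alpha}_{R}\big(\mathbf{X}^{k}-\alpha(\mathbf{D}^{\top}\mathbf{\Lambda}^{k}+\nabla F(\mathbf{X}^{k}))\big),\\ \mathbf{\Lambda}^{k+1}&=\arg\min_{\mathbf{\Lambda}\in\mathcal{Y}}\Big\{\tfrac12\|\mathbf{\Lambda}-\mathbf{\Lambda}^k\|^2_{\mathbf{Q}}+\langle\mathbf{\Lambda},\mathbf{d}-\mathbf{D}\bar{\mathbf{X}}^k\rangle\Big\},\\ \mathbf{X}^{k+1}&=\bar{\mathbf{X}}^{k}+\alpha\mathbf{D}^{\top}(\mathbf{\Lambda}^k-\mathbf{\Lambda}^{k+1}). \end{align*} Write $\mathbf{W}^k=(\mathbf{X}^k,\mathbf{\Lambda}^k)$ and $\mathbf{V}^{k+1}=(\bar{\mathbf{X}}^k,\mathbf{\Lambda}^{k+1})$, and define the self-adjoint operators on $\mathcal{W}$ $$\mathbf{H}(\mathbf{X},\mathbf{\Lambda})=\big(\tfrac1\alpha\mathbf{X},\mathbf{Q}\mathbf{\Lambda}\big),\qquad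 \mathbf{M}(\mathbf{X},\mathbf{\Lambda})=\big((\tfrac1\alpha-\tfrac L2)\mathbf{X},(\mathbf{Q}-\alpha\mathbf{D}\mathbf{D}^{\top})\mathbf{\Lambda}\big).$$ 1. If $\alpha\in(0,2/L)$ and $\mathbf{J}\succ0$, then for any $\mathbf{W}^*\in\mathcal{W}^*$ (and every integer $K\ge0$) $$\lim_{k\to\infty}k\|\mathbf{V}^{k+1}-\mathbf{W}^k\|^2_{\mathbf{M}}=0,\qquad \min_{0\le k\le K}\|\mathbf{V}^{k+1}-\mathbf{W}^k\|^2_{\mathbf{M}}\le\frac{\|\mathbf{W}^0-\mathbf{W}^*\|^2_{\mathbf{H}}}{K+1}.$$ 2. If $\alpha\in(0,1/L)$ and $\mathbf{J}\succ0$, then for every integer $K\ge1$, with $\bar{\mathbf{X}}_K=\frac1K\sum_{k=0}^{K-1}\bar{\mathbf{X}}^k$ and $\mathbf{\Lambda}_K=\frac1K\sum_{k=0}^{K-1}\mathbf{\Lambda}^{k+1}$, $$\mathcal{L}(\bar{\mathbf{X}}_K,\mathbf{\Lambda})-\mathcal{L}(\mathbf{X},\mathbf{\Lambda}_K)\le\frac{\|\mathbf{W}^0-\mathbf{W}\|^2_{\mathbf{H}}}{2K}\qquad\text{for all }\mathbf{W}=(\mathbf{X},\mathbf{\Lambda})\in\mathcal{W}.$$ Furthermore, for $(\mathbf{X}^*,\mathbf{\Lambda}^* )\in\mathcal{W}^*$ and $\rho=\max\{1+\|\mathbf{\Lambda}^*\|,2\|\mathbf{\Lambda}^*\|\}$,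 with $\Phi=F+R$, $$|\Phi(\bar{\mathbf{X}}_K)-\Phi(\mathbf{X}^* )|\le\frac{\frac1\alpha\|\mathbf{X}^0-\mathbf{X}^*\|^2+\rho^2\|\mathbf{Q}\|}{2K},\qquad \|\mathbf{D}\bar{\mathbf{X}}_K-\mathbf{d}\|\le\frac{\frac1\alpha\|\mathbf{X}^0-\mathbf{X}^*\|^2+\rho^2\|\mathbf{Q}\|}{2K}.$$
   Context: Problem: $\min_{\mathrm{x}\in\mathbb{R}^n} f(\mathrm{x})+r(\mathrm{B}\mathrm{x})+\delta_0(\mathrm{D}\mathrm{x}-\mathrm{d})$, where $\mathrm{B}\in\mathbb{R}^{p_1\times n}$, $\mathrm{D}\in\mathbb{R}^{p_2\times n}$, $\mathrm{d}\in\mathbb{R}^{p_2}$, and $\delta_0(z)=0$ if $z=0$, $+\infty$ otherwise. Standing assumptions: the solution set is nonempty; $f:\mathbb{R}^n\to\mathbb{R}$ is convex and differentiable with $L$-Lipschitz gradient ($L>0$); $r:\mathbb{R}^{p_1}\to(-\infty,+\infty]$ is proper, closed and convex. Reformulation: $\mathcal{X}=\mathbb{R}^{n+p_1}$, $\mathcal{Y}=\mathbb{R}^{p_2+p_1}$, $\mathcal{W}=\mathcal{X}\times\mathcal{Y}$; for $\mathbf{X}=(\mathrm{x},\mathrm{y})\in\mathcal{X}$ put $F(\mathbf{X})=f(\mathrm{x})$, $R(\mathbf{X})=r(\mathrm{y})$, $\mathbf{D}\mathbf{X}=(\mathrm{D}\mathrm{x},\mathrm{B}\mathrm{x}-\mathrm{y})\in\mathcal{Y}$,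 and $\mathbf{d}=(\mathrm{d},0)\in\mathcal{Y}$. The Lagrangian is $\mathcal{L}(\mathbf{X},\mathbf{\Lambda})=F(\mathbf{X})+R(\mathbf{X})+\langle\mathbf{\Lambda},\mathbf{D}\mathbf{X}-\mathbf{d}\rangle$ on $\mathcal{W}$, and $\mathcal{W}^*$ is the set of its saddle points, i.e. of $(\mathbf{X}^*,\mathbf{\Lambda}^* )$ with $\mathcal{L}(\mathbf{X}^*,\mathbf{\Lambda})\le\mathcal{L}(\mathbf{X}^*,\mathbf{\Lambda}^* )\le\mathcal{L}(\mathbf{X},\mathbf{\Lambda}^* )$ for all $(\mathbf{X},\mathbf{\Lambda})\in\mathcal{W}$. One has $\mathcal{W}^*=\mathcal{X}^*\times\mathcal{Y}^*$, with $\mathcal{X}^*$ the set of minimizers of $F+R$ subject to $\mathbf{D}\mathbf{X}=\mathbf{d}$ and $\mathcal{Y}^*$ the set of dual optimal solutions. Strong duality is assumed: $\mathcal{W}^*\neq\emptyset$. $\mathbf{Q}$ is a given self-adjoint linear operator on $\mathcal{Y}$. For a self-adjoint $H$, $\|x\|_H^2=\langle x,Hx\rangle$, and $H\succ0$ means positive definite; $\|\mathbf{Q}\|$ is the operator norm. $\mathrm{prox}^{\alpha}_{R}(\mathbf{Z})=\arg\min_{\mathbf{V}}\{R(\mathbf{V})+\frac{1}{2\alpha}\|\mathbf{V}-\mathbf{Z}\|^2\}$. When $R(\mathbf{X})=+\infty$ the inequality on $\mathcal{L}(\bar{\mathbf{X}}_K,\mathbf{\Lambda})-\mathcal{L}(\mathbf{X},\mathbf{\Lambda}_K)$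 is understood as trivially true (left-hand side $-\infty$). *)

theory Defs
  imports "HOL-Analysis.Analysis"
begin

definition gradient :: "('a::real_inner \<Rightarrow> real) \<Rightarrow> 'a \<Rightarrow> 'a" where
  "gradient f x = (THE g. GDERIV f x :> g)"

text \<open>
  An extended-valued function is convex (closed) iff its epigraph is convex (closed). Closedness
  of the epigraph is lower semicontinuity.
\<close>

definition ereal_epigraph :: "('a \<Rightarrow> ereal) \<Rightarrow> ('a \<times> real) set" where
  "ereal_epigraph r = {(y, t). r y \<le> ereal t}"

definition proper_fun :: "('a \<Rightarrow> ereal) \<Rightarrow> bool" where
  "proper_fun r \<longleftrightarrow> (\<forall>y. r y \<noteq> -\<infinity>) \<and> (\<exists>y. r y \<noteq> \<infinity>)"

definition closed_fun :: "('a::topological_space \<Rightarrow> ereal) \<Rightarrow> bool" where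
  "closed_fun r \<longleftrightarrow> closed (ereal_epigraph r)"

definition convex_fun :: "('a::real_vector \<Rightarrow> ereal) \<Rightarrow> bool" where
  "convex_fun r \<longleftrightarrow> convex (ereal_epigraph r)"

text \<open>
  For proper closed convex \<open>R\<close> and \<open>\<alpha> > 0\<close> in finite dimension the minimizer exists and is
  unique, so the arbitrary choice made by \<open>arg_min\<close> is immaterial.
\<close>

definition prox :: "real \<Rightarrow> ('a::real_normed_vector \<Rightarrow> ereal) \<Rightarrow> 'a \<Rightarrow> 'a" where
  "prox \<alpha> R Z = arg_min (\<lambda>V. R V + ereal (1 / (2 * \<alpha>) * (norm (V - Z))\<^sup>2)) (\<lambda>_. True)"

definition self_adjoint :: "('a::real_inner \<Rightarrow> 'a) \<Rightarrow> bool" where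
  "self_adjoint H \<longleftrightarrow> linear H \<and> (\<forall>x y. H x \<bullet> y = x \<bullet> H y)"

definition pos_def :: "('a::real_inner \<Rightarrow> 'a) \<Rightarrow> bool" where
  "pos_def H \<longleftrightarrow> self_adjoint H \<and> (\<forall>x. x \<noteq> 0 \<longrightarrow> x \<bullet> H x > 0)"

text \<open>The squared weighted (semi)norm; it may be negative when the operator is indefinite.\<close>

definition norm_sq :: "('a::real_inner \<Rightarrow> 'a) \<Rightarrow> 'a \<Rightarrow> real" where
  "norm_sq H x = x \<bullet> H x"

definition delta0 :: "'a::zero \<Rightarrow> ereal" where
  "delta0 z = (if z = 0 then 0 else \<infinity>)"

definition objective ::
  "(real^'n \<Rightarrow> real) \<Rightarrow> (real^'p1 \<Rightarrow> ereal) \<Rightarrow> real^'n^'p1 \<Rightarrow> real^'n^'p2 \<Rightarrow> real^'p2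
    \<Rightarrow> real^'n \<Rightarrow> ereal" where
  "objective f r B D d x = ereal (f x) + r (B *v x) + delta0 (D *v x - d)"

text \<open>A solution is a minimizer with finite objective value, hence in particular feasible.\<close>

definition solution_set ::
  "(real^'n \<Rightarrow> real) \<Rightarrow> (real^'p1 \<Rightarrow> ereal) \<Rightarrow> real^'n^'p1 \<Rightarrow> real^'n^'p2 \<Rightarrow> real^'p2
    \<Rightarrow> (real^'n) set" where
  "solution_set f r B D d =
    {x. objective f r B D d x < \<infinity> \<and> (\<forall>x'. objective f r B D d x \<le> objective f r B D d x')}"

text \<open>
  The product types carry the Euclidean inner product and norm, so \<open>(real^'n) \<times> (real^'p1)\<close> is
  \<open>\<X>\<close> and \<open>(real^'p2) \<times> (real^'p1)\<close> is \<open>\<Y>\<close>.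
\<close>

definition F_ext :: "(real^'n \<Rightarrow> real) \<Rightarrow> (real^'n) \<times> (real^'p1) \<Rightarrow> real" where
  "F_ext f X = f (fst X)"

definition R_ext :: "(real^'p1 \<Rightarrow> ereal) \<Rightarrow> (real^'n) \<times> (real^'p1) \<Rightarrow> ereal" where
  "R_ext r X = r (snd X)"

definition D_ext ::
  "real^'n^'p1 \<Rightarrow> real^'n^'p2 \<Rightarrow> (real^'n) \<times> (real^'p1) \<Rightarrow> (real^'p2) \<times> (real^'p1)" where
  "D_ext B D X = (D *v fst X, B *v fst X - snd X)"

definition d_ext :: "real^'p2 \<Rightarrow> (real^'p2) \<times> (real^'p1)" where
  "d_ext d = (d, 0)"

definition Phi ::
  "(real^'n \<Rightarrow> real) \<Rightarrow> (real^'p1 \<Rightarrow> ereal) \<Rightarrow> (real^'n) \<times> (real^'p1) \<Rightarrow> ereal" where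
  "Phi f r X = ereal (F_ext f X) + R_ext r X"

text \<open>
  The values are never \<open>-\<infinity>\<close> for proper \<open>r\<close>. In a difference \<open>a - b\<close> of extended reals with
  \<open>a\<close> finite and \<open>b = \<infinity>\<close> the result is \<open>-\<infinity>\<close>, whereas \<open>\<infinity> - \<infinity> = \<infinity>\<close>.
\<close>

definition Lagrangian ::
  "(real^'n \<Rightarrow> real) \<Rightarrow> (real^'p1 \<Rightarrow> ereal) \<Rightarrow> real^'n^'p1 \<Rightarrow> real^'n^'p2 \<Rightarrow> real^'p2
    \<Rightarrow> (real^'n) \<times> (real^'p1) \<Rightarrow> (real^'p2) \<times> (real^'p1) \<Rightarrow> ereal" where
  "Lagrangian f r B D d X \<Lambda> =
    ereal (F_ext f X) + R_ext r X + ereal (\<Lambda> \<bullet> (D_ext B D X - d_ext d))"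

definition saddle_points ::
  "(real^'n \<Rightarrow> real) \<Rightarrow> (real^'p1 \<Rightarrow> ereal) \<Rightarrow> real^'n^'p1 \<Rightarrow> real^'n^'p2 \<Rightarrow> real^'p2
    \<Rightarrow> (((real^'n) \<times> (real^'p1)) \<times> ((real^'p2) \<times> (real^'p1))) set" where
  "saddle_points f r B D d =
    {(Xs, \<Lambda>s). \<forall>X \<Lambda>. Lagrangian f r B D d Xs \<Lambda> \<le> Lagrangian f r B D d Xs \<Lambda>s \<and>
                     Lagrangian f r B D d Xs \<Lambda>s \<le> Lagrangian f r B D d X \<Lambda>s}"

definition J_op ::
  "real \<Rightarrow> real^'n^'p1 \<Rightarrow> real^'n^'p2 \<Rightarrow> ((real^'p2) \<times> (real^'p1) \<Rightarrow> (real^'p2) \<times> (real^'p1))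
    \<Rightarrow> (real^'p2) \<times> (real^'p1) \<Rightarrow> (real^'p2) \<times> (real^'p1)" where
  "J_op \<alpha> B D Q \<Lambda> = Q \<Lambda> - \<alpha> *\<^sub>R D_ext B D (adjoint (D_ext B D) \<Lambda>)"

definition H_op ::
  "real \<Rightarrow> ((real^'p2) \<times> (real^'p1) \<Rightarrow> (real^'p2) \<times> (real^'p1))
    \<Rightarrow> ((real^'n) \<times> (real^'p1)) \<times> ((real^'p2) \<times> (real^'p1))
    \<Rightarrow> ((real^'n) \<times> (real^'p1)) \<times> ((real^'p2) \<times> (real^'p1))" where
  "H_op \<alpha> Q W = ((1 / \<alpha>) *\<^sub>R fst W, Q (snd W))"

definition M_op ::
  "real \<Rightarrow> real \<Rightarrow> real^'n^'p1 \<Rightarrow> real^'n^'p2 \<Rightarrow> ((real^'p2) \<times> (real^'p1) \<Rightarrow> (real^'p2) \<times> (real^'p1))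
    \<Rightarrow> ((real^'n) \<times> (real^'p1)) \<times> ((real^'p2) \<times> (real^'p1))
    \<Rightarrow> ((real^'n) \<times> (real^'p1)) \<times> ((real^'p2) \<times> (real^'p1))" where
  "M_op \<alpha> L B D Q W = ((1 / \<alpha> - L / 2) *\<^sub>R fst W, J_op \<alpha> B D Q (snd W))"

definition ergodic_mean :: "nat \<Rightarrow> (nat \<Rightarrow> 'a::real_vector) \<Rightarrow> 'a" where
  "ergodic_mean K u = (1 / real K) *\<^sub>R (\<Sum>k<K. u k)"

end

theory Submission
  imports Defs
begin

text \<open>
  Put \<open>\<parallel>(x, l)\<parallel>\<^sub>H\<^sup>2 = \<parallel>x\<parallel>\<^sup>2/\<alpha> + \<langle>l, Q l\<rangle>\<close>. One iteration reads \<open>H (W - W') \<in> T V' + (\<nabla>F X, 0)\<close>, where \<open>W'\<close>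
  is the new iterate and \<open>T\<close> is the monotone operator \<open>(X, \<Lambda>) \<mapsto> (\<partial>R X + A\<^sup>T \<Lambda>, b - A X)\<close>. Expanding the
  square and absorbing the gradient by its cocoercivity shows that for two runs of the iteration
  \<open>\<parallel>\<Delta>W'\<parallel>\<^sub>H\<^sup>2 + \<parallel>\<Delta>(V' - W)\<parallel>\<^sub>M\<^sup>2 \<le> \<parallel>\<Delta>W\<parallel>\<^sub>H\<^sup>2\<close>. Saddle points are fixed points, so the residuals
  \<open>\<parallel>V' - W\<parallel>\<^sub>M\<^sup>2\<close> are summable. The increments \<open>\<parallel>W' - W\<parallel>\<^sub>H\<^sup>2\<close> decrease (compare the run
  with its own shift) and are equivalent to the residuals up to constants; this gives the rate \<open>o(1/k)\<close>.

  For the ergodic bounds the same expansion gives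
  \<open>2 (\<L>(Xbar, \<Lambda>) - \<L>(X, \<Lambda>')) \<le> \<parallel>W - (X, \<Lambda>)\<parallel>\<^sub>H\<^sup>2 - \<parallel>W' - (X, \<Lambda>)\<parallel>\<^sub>H\<^sup>2\<close>, which telescopes. The bounds on objective and
  feasibility follow by taking for \<open>\<Lambda>\<close> the multiple of norm \<open>\<rho>\<close> of the constraint residual.
\<close>

subsection \<open>Smooth convex functions, subgradients and proximal points\<close>

text \<open>This is the limit t to 0 of first-order arguments: an inequality along a segment is
  divided by t, and a quadratic error survives only as t times a constant.\<close>

lemma le_of_le_add_scaled:
  fixes a b c :: real
  assumes "\<And>t. 0 < t \<Longrightarrow> t \<le> 1 \<Longrightarrow> a \<le> b + t * c"
  shows "a \<le> b"
proof (rule field_le_epsilon)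
  fix e :: real assume "e > 0"
  \<comment> \<open>The added 1 keeps the quotient positive when c = 0.\<close>
  define t where "t = min 1 (e / (\<bar>c\<bar> + 1))"
  have t: "0 < t" "t \<le> 1" "t \<le> e / (\<bar>c\<bar> + 1)"
    using \<open>e > 0\<close> by (auto simp: t_def)
  have "t * c \<le> t * (\<bar>c\<bar> + 1)" using t by (intro mult_left_mono) auto
  also have "\<dots> \<le> e" using t(3) by (simp add: pos_le_divide_eq)
  finally show "a \<le> b + e" using assms[OF t(1,2)] by linarith
qed

lemma GDERIV_along_line:
  assumes "GDERIV F (x + t *\<^sub>R h) :> g"
  shows "((\<lambda>s. F (x + s *\<^sub>R h)) has_real_derivative g \<bullet> h) (at t)"
proof -
  have "(F has_derivative (\<lambda>h. h \<bullet> g)) (at (x + t *\<^sub>R h))"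
    using assms by (simp add: gderiv_def)
  moreover have "((\<lambda>s. x + s *\<^sub>R h) has_derivative (\<lambda>s. s *\<^sub>R h)) (at t)"
    by (auto intro!: derivative_eq_intros)
  ultimately have "((\<lambda>s. F (x + s *\<^sub>R h)) has_derivative (\<lambda>s. (s *\<^sub>R h) \<bullet> g)) (at t)"
    by (rule has_derivative_compose[rotated])
  then show ?thesis
    by (simp add: has_field_derivative_def inner_commute mult_commute_abs)
qed

lemma GDERIV_unique:
  assumes "GDERIV F x :> g" "GDERIV F x :> g'"
  shows "g = g'"
proof -
  have "(\<lambda>h. h \<bullet> g) = (\<lambda>h. h \<bullet> g')"
    using assms has_derivative_unique unfolding gderiv_def by blast
  then have "(g - g') \<bullet> g = (g - g') \<bullet> g'" by (rule fun_cong)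
  then show ?thesis by (metis inner_diff_right inner_eq_zero_iff right_minus_eq)
qed

lemma gradient_eqI: "GDERIV F x :> g \<Longrightarrow> gradient F x = g"
  unfolding gradient_def using GDERIV_unique by blast

lemma GDERIV_gradient:
  fixes F :: "'a::euclidean_space \<Rightarrow> real"
  assumes "F differentiable (at x)"
  shows "GDERIV F x :> gradient F x"
proof -
  obtain F' where F': "(F has_derivative F') (at x)"
    using assms by (auto simp: differentiable_def)
  then have "linear F'" by (rule has_derivative_linear)
  then have "F' = (\<lambda>h. h \<bullet> adjoint F' 1)"
    by (simp add: adjoint_works)
  then have "GDERIV F x :> adjoint F' 1" using F' by (simp add: gderiv_def)
  then show ?thesis using gradient_eqI by metis
qed

text \<open>Smoothness is separated from convexity so that the quadratic bound also applies to -F,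
  where it becomes a lower bound on F.\<close>

locale smooth_fun =
  fixes F :: "'a::euclidean_space \<Rightarrow> real" and gF :: "'a \<Rightarrow> 'a" and L :: real
  assumes gderiv: "\<And>x. GDERIV F x :> gF x"
    and lipschitz: "L-lipschitz_on UNIV gF"
begin

lemma upper_bound: "F (x + h) \<le> F x + gF x \<bullet> h + L / 2 * (norm h)\<^sup>2"
proof -
  \<comment> \<open>Up to the constant F x, this is F along the segment minus the claimed bound for
    the step t h. The Lipschitz condition makes its derivative nonpositive on [0, 1].\<close>
  define \<phi> where "\<phi> t = F (x + t *\<^sub>R h) - t * (gF x \<bullet> h) - L / 2 * t\<^sup>2 * (norm h)\<^sup>2" for t
  have "\<phi> 1 \<le> \<phi> 0"
  proof (rule DERIV_nonpos_imp_nonincreasing[where f = \<phi> and a = 0 and b = 1])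
    fix t :: real assume t: "0 \<le> t" "t \<le> 1"
    have "(\<phi> has_real_derivative
        gF (x + t *\<^sub>R h) \<bullet> h - gF x \<bullet> h - L * t * (norm h)\<^sup>2) (at t)"
      unfolding \<phi>_def
      by (auto intro!: derivative_eq_intros GDERIV_along_line gderiv)
    moreover have "gF (x + t *\<^sub>R h) \<bullet> h - gF x \<bullet> h - L * t * (norm h)\<^sup>2 \<le> 0"
    proof -
      have "gF (x + t *\<^sub>R h) \<bullet> h - gF x \<bullet> h \<le> norm (gF (x + t *\<^sub>R h) - gF x) * norm h"
        by (metis inner_diff_left norm_cauchy_schwarz)
      also have "\<dots> \<le> (L * (t * norm h)) * norm h"
        using lipschitz_onD[OF lipschitz, of "x + t *\<^sub>R h" x] t
        by (intro mult_right_mono) (auto simp: dist_norm)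
      finally show ?thesis by (simp add: power2_eq_square mult.assoc)
    qed
    ultimately show "\<exists>y. DERIV \<phi> t :> y \<and> y \<le> 0" by blast
  qed simp
  then show ?thesis by (simp add: \<phi>_def)
qed

end

locale smooth_convex_fun = smooth_fun +
  assumes convex: "convex_on UNIV F" and L_pos: "L > 0"
begin

lemma neg_smooth: "smooth_fun (\<lambda>x. - F x) (\<lambda>x. - gF x) L"
proof
  show "GDERIV (\<lambda>x. - F x) x :> - gF x" for x by (rule GDERIV_minus[OF gderiv])
  show "L-lipschitz_on UNIV (\<lambda>x. - gF x)" using lipschitz by (rule lipschitz_on_minus)
qed

lemma gradient_ineq: "F x + gF x \<bullet> (y - x) \<le> F y"
proof -
  have "gF x \<bullet> (y - x) \<le> F y - F x"
  proof (rule le_of_le_add_scaled)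
    fix t :: real assume t: "0 < t" "t \<le> 1"
    have "F (x + t *\<^sub>R (y - x)) \<le> (1 - t) * F x + t * F y"
      using convex_onD[OF convex, of t x y] t by (simp add: algebra_simps)
    \<comment> \<open>The quadratic bound for -F supports F from below near x; compared with
      convexity along the segment, it leaves an error of order t after division by t.\<close>
    moreover have "F x + t * (gF x \<bullet> (y - x)) - L / 2 * (t\<^sup>2 * (norm (y - x))\<^sup>2)
        \<le> F (x + t *\<^sub>R (y - x))"
      using smooth_fun.upper_bound[OF neg_smooth, of x "t *\<^sub>R (y - x)"]
      by (simp add: power_mult_distrib)
    ultimately have "t * (gF x \<bullet> (y - x)) \<le> t * (F y - F x + t * (L / 2 * (norm (y - x))\<^sup>2))"
      by (simp add: algebra_simps power2_eq_square)
    then show "gF x \<bullet> (y - x) \<le> F y - F x + t * (L / 2 * (norm (y - x))\<^sup>2)"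
      using t by simp
  qed
  then show ?thesis by simp
qed

text \<open>Minimize the tilted function \<open>F - \<langle>gF x, \<cdot>\<rangle>\<close>, whose minimum is at \<open>x\<close>, by one gradient
  step of length \<open>1/L\<close> from \<open>y\<close>.\<close>

lemma gradient_ineq_strong:
  "F x + gF x \<bullet> (y - x) + 1 / (2 * L) * (norm (gF y - gF x))\<^sup>2 \<le> F y"
proof -
  define g where "g = gF y - gF x"
  define z where "z = y - (1 / L) *\<^sub>R g"
  have "F x + gF x \<bullet> (z - x) \<le> F z" by (rule gradient_ineq)
  also have "F z \<le> F y + gF y \<bullet> (- (1 / L) *\<^sub>R g) + L / 2 * (norm ((- (1 / L)) *\<^sub>R g))\<^sup>2"
    using upper_bound[of y "- (1 / L) *\<^sub>R g"] by (simp add: z_def)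
  also have "(norm ((- (1 / L)) *\<^sub>R g))\<^sup>2 = (norm g)\<^sup>2 / L\<^sup>2"
    by (simp add: power_divide)
  finally have "F x + gF x \<bullet> (y - x) + (g \<bullet> g) / L - (norm g)\<^sup>2 / (2 * L) \<le> F y"
    using L_pos by (simp add: z_def g_def algebra_simps inner_simps power2_eq_square add_divide_distrib diff_divide_distrib)
  moreover have "(g \<bullet> g) / L - (norm g)\<^sup>2 / (2 * L) = 1 / (2 * L) * (norm g)\<^sup>2"
    using L_pos by (simp add: power2_norm_eq_inner field_simps)
  ultimately show ?thesis unfolding g_def[symmetric] by linarith
qed

text \<open>Add the strengthened gradient inequality for (x, y) to the one for (y, x): the function
  values cancel and the two terms with 1/(2L) sum to 1/L.\<close>

lemma cocoercive: "(gF x - gF y) \<bullet> (x - y) \<ge> 1 / L * (norm (gF x - gF y))\<^sup>2"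
proof -
  have "(norm (gF y - gF x))\<^sup>2 = (norm (gF x - gF y))\<^sup>2" by (simp add: norm_minus_commute)
  then show ?thesis
    using gradient_ineq_strong[of x y] gradient_ineq_strong[of y x] L_pos
    by (simp add: inner_simps field_simps)
qed

end

section \<open>Subgradients of extended-valued convex functions\<close>

definition subgrad :: "('a::real_inner \<Rightarrow> ereal) \<Rightarrow> 'a \<Rightarrow> 'a \<Rightarrow> bool" where
  "subgrad R x \<xi> \<longleftrightarrow> \<bar>R x\<bar> \<noteq> \<infinity> \<and> (\<forall>y. R x + ereal (\<xi> \<bullet> (y - x)) \<le> R y)"

lemma subgrad_monotone:
  assumes "subgrad R x \<xi>" "subgrad R y \<eta>"
  shows "(\<xi> - \<eta>) \<bullet> (x - y) \<ge> 0"
proof -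
  obtain a b where ab: "R x = ereal a" "R y = ereal b"
    using assms unfolding subgrad_def by (metis ereal_real)
  then have "a + \<xi> \<bullet> (y - x) \<le> b" "b + \<eta> \<bullet> (x - y) \<le> a"
    using assms unfolding subgrad_def by (metis ereal_less_eq(3) plus_ereal.simps(1))+
  then show ?thesis by (simp add: inner_simps)
qed

lemma convex_funD:
  assumes "convex_fun R" "R x \<le> ereal a" "R y \<le> ereal b" "0 \<le> t" "t \<le> 1"
  shows "R (x + t *\<^sub>R (y - x)) \<le> ereal (a + t * (b - a))"
proof -
  have "(1 - t) *\<^sub>R (x, a) + t *\<^sub>R (y, b) \<in> ereal_epigraph R"
    using assms unfolding convex_fun_def ereal_epigraph_def
    by (intro convexD) auto
  then show ?thesis by (simp add: ereal_epigraph_def algebra_simps)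
qed

text \<open>Fermat's rule for R + G, with a quadratic upper model in place of a derivative of G.
  Moving from x by a fraction t towards y changes R at most linearly in t by convexity, while the
  model error is of order t^2. It serves for the proximal quadratic and for the smooth part of the
  Lagrangian.\<close>

lemma subgrad_of_minimizer:
  assumes R: "proper_fun R" "convex_fun R"
    and min: "\<And>y. R x + ereal (G x) \<le> R y + ereal (G y)"
    and G: "\<And>y. G y \<le> G x + g \<bullet> (y - x) + c * (norm (y - x))\<^sup>2"
  shows "subgrad R x (- g)"
proof -
  obtain y0 where y0: "R y0 \<noteq> \<infinity>" using R by (auto simp: proper_fun_def)
  have ninf: "R y \<noteq> -\<infinity>" for y using R by (auto simp: proper_fun_def)
  have "R x \<noteq> \<infinity>"
    using min[of y0] y0 ninf[of y0] by (cases "R y0") auto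
  then obtain a where a: "R x = ereal a" using ninf[of x] by (cases "R x") auto
  have "R x + ereal (- g \<bullet> (y - x)) \<le> R y" for y
  proof (cases "R y")
    case (real b)
    have "a - g \<bullet> (y - x) \<le> b"
    proof (rule le_of_le_add_scaled)
      fix t :: real assume t: "0 < t" "t \<le> 1"
      let ?z = "x + t *\<^sub>R (y - x)"
      have "R ?z \<le> ereal (a + t * (b - a))"
        using convex_funD[OF R(2), of x a y b t] a real t by simp
      then have "ereal a + ereal (G x) \<le> ereal (a + t * (b - a)) + ereal (G ?z)"
        using min[of ?z] a by (metis add_right_mono order_trans)
      then have "G x \<le> t * (b - a) + G ?z" by simp
      also have "G ?z \<le> G x + t * (g \<bullet> (y - x)) + c * (t\<^sup>2 * (norm (y - x))\<^sup>2)"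
        using G[of ?z] by (simp add: power_mult_distrib)
      finally have "t * (a - g \<bullet> (y - x)) \<le> t * (b + t * (c * (norm (y - x))\<^sup>2))"
        by (simp add: algebra_simps power2_eq_square)
      then show "a - g \<bullet> (y - x) \<le> b + t * (c * (norm (y - x))\<^sup>2)" using t by simp
    qed
    then show ?thesis using a real by simp
  qed (use ninf in auto)
  then show ?thesis by (auto simp: subgrad_def a)
qed

text \<open>Separate a point lying strictly below the graph from the closed convex epigraph, and
  solve the separating hyperplane for the height.\<close>

lemma proper_closed_convex_affine_minorant:
  fixes R :: "'a::euclidean_space \<Rightarrow> ereal"
  assumes "proper_fun R" "closed_fun R" "convex_fun R"
  obtains p c where "\<And>y. ereal (p \<bullet> y + c) \<le> R y"
proof -
  obtain y0 where "R y0 \<noteq> \<infinity>" "R y0 \<noteq> -\<infinity>" using assms by (auto simp: proper_fun_def)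
  then obtain a where a: "R y0 = ereal a" by (cases "R y0") auto
  then have "(y0, a - 1) \<notin> ereal_epigraph R" by (simp add: ereal_epigraph_def)
  then obtain v \<beta> where v: "v \<bullet> (y0, a - 1) < \<beta>" "\<And>z. z \<in> ereal_epigraph R \<Longrightarrow> v \<bullet> z > \<beta>"
    using separating_hyperplane_closed_point[of "ereal_epigraph R"] assms
    unfolding closed_fun_def convex_fun_def by blast
  obtain p q where pq: "v = (p, q)" by (cases v)
  \<comment> \<open>The epigraph contains the point directly above the separated one, so the
    hyperplane is not vertical.\<close>
  have "(y0, a) \<in> ereal_epigraph R" using a by (simp add: ereal_epigraph_def)
  then have "p \<bullet> y0 + q * (a - 1) < p \<bullet> y0 + q * a"
    using v(1) v(2)[of "(y0, a)"] by (simp add: pq)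
  then have q: "q > 0" by (simp add: algebra_simps)
  have "ereal ((- (1 / q) *\<^sub>R p) \<bullet> y + \<beta> / q) \<le> R y" for y
  proof (cases "R y")
    case (real b)
    then have "p \<bullet> y + q * b > \<beta>"
      using v(2)[of "(y, b)"] by (simp add: pq ereal_epigraph_def)
    then show ?thesis using q real by (simp add: field_simps)
  qed (use assms in \<open>auto simp: proper_fun_def\<close>)
  then show ?thesis by (rule that)
qed

text \<open>Existence of a minimizer. The affine minorant cannot outweigh the quadratic term, so
  sublevel sets are compact.\<close>

lemma prox_is_minimizer:
  fixes R :: "'a::euclidean_space \<Rightarrow> ereal"
  assumes R: "proper_fun R" "closed_fun R" "convex_fun R" and \<alpha>: "\<alpha> > 0"
  shows "R (prox \<alpha> R Z) + ereal (1 / (2 * \<alpha>) * (norm (prox \<alpha> R Z - Z))\<^sup>2)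
    \<le> R y + ereal (1 / (2 * \<alpha>) * (norm (y - Z))\<^sup>2)"
proof -
  define c where "c = 1 / (2 * \<alpha>)"
  have c: "c > 0" using \<alpha> by (simp add: c_def)
  obtain p b where p: "\<And>y. ereal (p \<bullet> y + b) \<le> R y"
    using proper_closed_convex_affine_minorant[OF R] by blast
  obtain y0 where "R y0 \<noteq> \<infinity>" "R y0 \<noteq> -\<infinity>" using R by (auto simp: proper_fun_def)
  then obtain a where a: "R y0 = ereal a" by (cases "R y0") auto
  \<comment> \<open>The extended-valued problem becomes the minimization of a continuous real
    function over the epigraph, with the height as an extra variable.\<close>
  define \<psi> where "\<psi> z = snd z + c * (norm (fst z - Z))\<^sup>2" for z :: "'a \<times> real"
  define m where "m = \<psi> (y0, a)"
  define S where "S = ereal_epigraph R \<inter> {z. \<psi> z \<le> m}"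
  have cont: "continuous_on UNIV \<psi>"
    unfolding \<psi>_def by (intro continuous_intros)
  have "closed S"
    unfolding S_def using R cont
    by (intro closed_Int closed_Collect_le) (auto simp: closed_fun_def)
  moreover have "bounded S"
  proof -
    \<comment> \<open>The linear term of the minorant is absorbed by a quarter of the quadratic
      term; completing the square costs \<open>(norm p)\<^sup>2 / c\<close>.\<close>
    define e where "e = p \<bullet> Z + b - (norm p)\<^sup>2 / c"
    have lower: "snd z + c * (norm (fst z - Z))\<^sup>2 \<ge> e + 3 / 4 * c * (norm (fst z - Z))\<^sup>2"
      and lower': "snd z \<ge> p \<bullet> Z + b - norm p * norm (fst z - Z)"
      if z: "z \<in> ereal_epigraph R" for z
    proof -
      have "R (fst z) \<le> ereal (snd z)" using z by (auto simp: ereal_epigraph_def)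
      then have "p \<bullet> fst z + b \<le> snd z" using p[of "fst z"] order_trans by fastforce
      moreover have "- (norm p * norm (fst z - Z)) \<le> p \<bullet> (fst z - Z)"
        using Cauchy_Schwarz_ineq2[of p "fst z - Z"] by linarith
      ultimately show *: "snd z \<ge> p \<bullet> Z + b - norm p * norm (fst z - Z)"
        by (simp add: inner_simps)
      have "0 \<le> c * (norm p / c - norm (fst z - Z) / 2)\<^sup>2" using c by simp
      also have "\<dots> = (norm p)\<^sup>2 / c - norm p * norm (fst z - Z) + c / 4 * (norm (fst z - Z))\<^sup>2"
        using c by (simp add: power2_eq_square field_simps)
      finally show "snd z + c * (norm (fst z - Z))\<^sup>2 \<ge> e + 3 / 4 * c * (norm (fst z - Z))\<^sup>2"
        using * unfolding e_def by (simp add: algebra_simps)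
    qed
    define \<sigma> where "\<sigma> = sqrt ((m - e) / (3 / 4 * c))"
    have "z \<in> cball Z \<sigma> \<times> {p \<bullet> Z + b - norm p * \<sigma> .. m}" if z: "z \<in> S" for z
    proof -
      have zE: "z \<in> ereal_epigraph R" and zm: "snd z + c * (norm (fst z - Z))\<^sup>2 \<le> m"
        using z by (auto simp: S_def \<psi>_def)
      have "3 / 4 * c * (norm (fst z - Z))\<^sup>2 \<le> m - e" using lower[OF zE] zm by linarith
      then have "(norm (fst z - Z))\<^sup>2 \<le> (m - e) / (3 / 4 * c)" using c by (simp add: field_simps)
      then have n: "norm (fst z - Z) \<le> \<sigma>" unfolding \<sigma>_def by (rule real_le_rsqrt)
      then have "norm p * norm (fst z - Z) \<le> norm p * \<sigma>" by (intro mult_left_mono) auto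
      then have "snd z \<ge> p \<bullet> Z + b - norm p * \<sigma>" using lower'[OF zE] by linarith
      moreover have "snd z \<le> m" using zm c by (smt (verit) mult_nonneg_nonneg zero_le_power2)
      ultimately show ?thesis using n
        by (cases z) (auto simp: dist_norm norm_minus_commute)
    qed
    then have "S \<subseteq> cball Z \<sigma> \<times> {p \<bullet> Z + b - norm p * \<sigma> .. m}" by blast
    then show ?thesis by (rule bounded_subset[rotated]) (intro bounded_Times bounded_cball bounded_closed_interval)
  qed
  ultimately have "compact S" by (simp add: compact_eq_bounded_closed)
  moreover have "(y0, a) \<in> S" by (simp add: S_def m_def ereal_epigraph_def a)
  ultimately obtain z where z: "z \<in> S" "\<And>w. w \<in> S \<Longrightarrow> \<psi> z \<le> \<psi> w"
    using continuous_attains_inf[of S \<psi>] continuous_on_subset[OF cont, of S] by blast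
  \<comment> \<open>Points of the epigraph outside S have a value above m, hence above the value at
    z.\<close>
  have zmin: "\<psi> z \<le> \<psi> w" if "w \<in> ereal_epigraph R" for w
    using z(2)[of w] z(1) that by (cases "\<psi> w \<le> m") (auto simp: S_def)
  define \<Psi> where "\<Psi> V = R V + ereal (1 / (2 * \<alpha>) * (norm (V - Z))\<^sup>2)" for V
  have "\<Psi> (fst z) \<le> \<Psi> w" for w
  proof (cases "R w")
    case (real t)
    then have "ereal (\<psi> z) \<le> \<Psi> w"
      using zmin[of "(w, t)"] by (simp add: ereal_epigraph_def \<psi>_def \<Psi>_def c_def)
    moreover have "\<Psi> (fst z) \<le> ereal (\<psi> z)"
    proof -
      have "R (fst z) \<le> ereal (snd z)" using z(1) by (auto simp: S_def ereal_epigraph_def)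
      then have "\<Psi> (fst z) \<le> ereal (snd z) + ereal (1 / (2 * \<alpha>) * (norm (fst z - Z))\<^sup>2)"
        unfolding \<Psi>_def by (rule add_right_mono)
      then show ?thesis by (simp add: \<psi>_def c_def)
    qed
    ultimately show ?thesis by simp
  qed (use R in \<open>auto simp: proper_fun_def \<Psi>_def\<close>)
  \<comment> \<open>\<open>arg_min\<close> is a choice among minimizers, so exhibiting one minimizer
    determines what the choice satisfies.\<close>
  then have "is_arg_min \<Psi> (\<lambda>_. True) (fst z)" by (simp add: is_arg_min_linorder)
  then have "is_arg_min \<Psi> (\<lambda>_. True) (arg_min \<Psi> (\<lambda>_. True))"
    unfolding arg_min_def by (rule someI)
  then have "\<Psi> (arg_min \<Psi> (\<lambda>_. True)) \<le> \<Psi> y" by (simp add: is_arg_min_linorder)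
  moreover have "arg_min \<Psi> (\<lambda>_. True) = prox \<alpha> R Z"
    unfolding prox_def by (rule arg_cong[where f = "\<lambda>h. arg_min h _"]) (auto simp: \<Psi>_def)
  ultimately show ?thesis by (simp add: \<Psi>_def)
qed

lemma prox_subgrad:
  fixes R :: "'a::euclidean_space \<Rightarrow> ereal"
  assumes R: "proper_fun R" "closed_fun R" "convex_fun R" and \<alpha>: "\<alpha> > 0"
  shows "subgrad R (prox \<alpha> R Z) ((1 / \<alpha>) *\<^sub>R (Z - prox \<alpha> R Z))"
proof -
  let ?P = "prox \<alpha> R Z"
  have "subgrad R ?P (- ((1 / \<alpha>) *\<^sub>R (?P - Z)))"
  proof (rule subgrad_of_minimizer[OF R(1,3) prox_is_minimizer[OF R \<alpha>]])
    show "1 / (2 * \<alpha>) * (norm (y - Z))\<^sup>2 \<le> 1 / (2 * \<alpha>) * (norm (?P - Z))\<^sup>2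
        + (1 / \<alpha>) *\<^sub>R (?P - Z) \<bullet> (y - ?P) + 1 / (2 * \<alpha>) * (norm (y - ?P))\<^sup>2" for y
    proof -
      \<comment> \<open>Expanding the square around the proximal point is exact, so the quadratic
        model holds with equality.\<close>
      have "(norm (y - Z))\<^sup>2 = (norm (?P - Z))\<^sup>2 + 2 * ((?P - Z) \<bullet> (y - ?P)) + (norm (y - ?P))\<^sup>2"
        by (simp add: power2_norm_eq_inner inner_simps inner_commute)
      then show ?thesis unfolding inner_scaleR_left using \<alpha> by (simp add: field_simps)
    qed
  qed
  moreover have "- ((1 / \<alpha>) *\<^sub>R (?P - Z)) = (1 / \<alpha>) *\<^sub>R (Z - ?P)"
    by (simp add: algebra_simps)
  ultimately show ?thesis by metis
qed

text \<open>The block of indices from n div 2 to n - 1 has at least n/2 members, each with a term at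
  least a n. Its sum is a difference of partial sums and tends to 0.\<close>

lemma decreasing_summable_small_o:
  fixes a :: "nat \<Rightarrow> real"
  assumes nonneg: "\<And>n. 0 \<le> a n" and dec: "decseq a" and sum: "summable a"
  shows "(\<lambda>n. real n * a n) \<longlonglongrightarrow> 0"
proof -
  define S where "S n = (\<Sum>k<n. a k)" for n
  have S: "S \<longlonglongrightarrow> suminf a" unfolding S_def by (rule summable_LIMSEQ[OF sum])
  have div2: "filterlim (\<lambda>n::nat. n div 2) at_top at_top"
    by (rule filterlim_at_top_div_const_nat) simp
  have "(\<lambda>n. 2 * (S n - S (n div 2))) \<longlonglongrightarrow> 2 * (suminf a - suminf a)"
    by (intro tendsto_intros S filterlim_compose[OF S div2])
  then have lim: "(\<lambda>n. 2 * (S n - S (n div 2))) \<longlonglongrightarrow> 0" by simp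
  have bound: "real n * a n \<le> 2 * (S n - S (n div 2))" for n
  proof -
    have "real (n - n div 2) * a n = (\<Sum>k = n div 2..<n. a n)" by simp
    also have "\<dots> \<le> (\<Sum>k = n div 2..<n. a k)"
      by (intro sum_mono decseqD[OF dec]) simp
    also have "\<dots> = S n - S (n div 2)"
      using sum_diff_nat_ivl[of 0 "n div 2" n a] by (simp add: S_def atLeast0LessThan)
    finally have half: "real (n - n div 2) * a n \<le> S n - S (n div 2)" .
    have "real n \<le> 2 * real (n - n div 2)" by linarith
    then have "real n * a n \<le> 2 * (real (n - n div 2) * a n)"
      using mult_right_mono[OF _ nonneg[of n]] by (metis mult.assoc)
    also have "\<dots> \<le> 2 * (S n - S (n div 2))"
      using half by (rule mult_left_mono) simp
    finally show ?thesis .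
  qed
  show ?thesis
    by (rule tendsto_sandwich[OF _ _ tendsto_const lim]) (use bound nonneg in auto)
qed

text \<open>The constant is the minimum of the quadratic form on the compact unit sphere;
  homogeneity does the rest.\<close>

lemma pos_def_coercive:
  fixes H :: "'a::euclidean_space \<Rightarrow> 'a"
  assumes "pos_def H"
  obtains c where "c > 0" "\<And>x. c * (norm x)\<^sup>2 \<le> x \<bullet> H x"
proof -
  have lin: "linear H" and pos: "\<And>x. x \<noteq> 0 \<Longrightarrow> x \<bullet> H x > 0"
    using assms by (auto simp: pos_def_def self_adjoint_def)
  have cont: "continuous_on (sphere 0 1) (\<lambda>x. x \<bullet> H x)"
    using lin by (intro continuous_intros linear_continuous_on) (simp add: linear_linear)
  have ne: "sphere (0::'a) 1 \<noteq> {}" by simp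
  obtain u where u: "u \<in> sphere 0 1" "\<And>v. v \<in> sphere 0 1 \<Longrightarrow> u \<bullet> H u \<le> v \<bullet> H v"
    using continuous_attains_inf[OF compact_sphere ne cont] by blast
  have "(u \<bullet> H u) * (norm x)\<^sup>2 \<le> x \<bullet> H x" for x
  proof (cases "x = 0")
    case False
    define v where "v = (1 / norm x) *\<^sub>R x"
    have "x = norm x *\<^sub>R v" using False by (simp add: v_def)
    then have "x \<bullet> H x = (norm x)\<^sup>2 * (v \<bullet> H v)"
      using linear_cmul[OF lin, of "norm x" v] by (metis inner_scaleR_left inner_scaleR_right mult.assoc power2_eq_square)
    moreover have "v \<in> sphere 0 1" using False by (simp add: v_def)
    ultimately show ?thesis using u(2)[of v] by (simp add: mult.commute[of "(norm x)\<^sup>2"] mult_right_mono)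
  qed (simp add: linear_0[OF lin])
  moreover have "u \<bullet> H u > 0" by (rule pos) (use u(1) in auto)
  ultimately show ?thesis using that by blast
qed

subsection \<open>The primal-dual step\<close>

text \<open>The lifted problem without its block structure: minimize F + R subject to A x = b in
  Euclidean spaces.\<close>

locale pd_problem = smooth_convex_fun F gF L
  for F :: "'a::euclidean_space \<Rightarrow> real" and gF :: "'a \<Rightarrow> 'a" and L :: real +
  fixes R :: "'a \<Rightarrow> ereal" and A :: "'a \<Rightarrow> 'b::euclidean_space" and b :: 'b
    and Q :: "'b \<Rightarrow> 'b" and \<alpha> :: real
  assumes R_proper: "proper_fun R" and R_closed: "closed_fun R" and R_convex: "convex_fun R"
    and A_linear: "linear A" and Q_self_adjoint: "self_adjoint Q" and \<alpha>_pos: "\<alpha> > 0"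
begin

abbreviation At :: "'b \<Rightarrow> 'a" where "At \<equiv> adjoint A"

definition J :: "'b \<Rightarrow> 'b" where "J l = Q l - \<alpha> *\<^sub>R A (At l)"

definition hsq :: "'a \<Rightarrow> 'b \<Rightarrow> real" where "hsq x l = (norm x)\<^sup>2 / \<alpha> + l \<bullet> Q l"

definition msq :: "'a \<Rightarrow> 'b \<Rightarrow> real" where
  "msq x l = (1 / \<alpha> - L / 2) * (norm x)\<^sup>2 + l \<bullet> J l"

lemma At_linear: "linear At" by (rule adjoint_linear[OF A_linear])

lemma inner_At: "At l \<bullet> x = l \<bullet> A x" by (rule adjoint_clauses(2)[OF A_linear])

lemma Q_linear: "linear Q" using Q_self_adjoint by (simp add: self_adjoint_def)

lemma Q_sym: "m \<bullet> Q l = l \<bullet> Q m"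
  using Q_self_adjoint by (metis inner_commute self_adjoint_def)

lemma inner_J: "l \<bullet> J l = l \<bullet> Q l - \<alpha> * (norm (At l))\<^sup>2"
  by (simp add: J_def inner_diff_right power2_norm_eq_inner inner_At)

lemma msq_minus: "msq (x - y) (l - m) = msq (y - x) (m - l)"
proof -
  have "Q (m - l) = - Q (l - m)" by (simp add: linear_diff[OF Q_linear])
  moreover have "At (m - l) = - At (l - m)" by (simp add: linear_diff[OF At_linear])
  ultimately have "(m - l) \<bullet> J (m - l) = (l - m) \<bullet> J (l - m)"
    unfolding inner_J by (simp add: inner_diff_left)
  then show ?thesis by (simp add: msq_def norm_minus_commute)
qed

text \<open>One iteration by its optimality conditions. The correction x' = xb + ... turns (x -
  xb)/\<alpha> - At l into (x - x')/\<alpha> - At l'. As a relation it also covers the constant run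
  at a saddle point.\<close>

definition pd_step :: "'a \<Rightarrow> 'b \<Rightarrow> 'a \<Rightarrow> 'a \<Rightarrow> 'b \<Rightarrow> bool" where
  "pd_step x l xb x' l' \<longleftrightarrow>
    subgrad R xb ((1 / \<alpha>) *\<^sub>R (x - x') - At l' - gF x) \<and> Q (l' - l) = A xb - b \<and>
    x' = xb + \<alpha> *\<^sub>R At (l - l')"

text \<open>Expand the primal and the dual squares separately. The primal correction contributes
  \<open>- \<alpha> * (norm (At (l - l')))\<^sup>2\<close>, which turns the Q form of l - l' into
  its J form.\<close>

lemma three_point:
  assumes "x' = xb + \<alpha> *\<^sub>R At (l - l')"
  shows "hsq (x - z) (l - m) - hsq (x' - z) (l' - m) =
    (norm (x - xb))\<^sup>2 / \<alpha> + (l - l') \<bullet> J (l - l')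
      + 2 * ((1 / \<alpha>) *\<^sub>R (x - x') \<bullet> (xb - z)) + 2 * ((l' - m) \<bullet> Q (l - l'))"
proof -
  define p where "p = At (l - l')"
  have x': "x' = xb + \<alpha> *\<^sub>R p" using assms by (simp add: p_def)
  have "\<alpha> * ((norm (x - z))\<^sup>2 / \<alpha> - (norm (x' - z))\<^sup>2 / \<alpha>) =
      \<alpha> * ((norm (x - xb))\<^sup>2 / \<alpha> - \<alpha> * (norm p)\<^sup>2 + 2 * ((1 / \<alpha>) *\<^sub>R (x - x') \<bullet> (xb - z)))"
    unfolding x' power2_norm_eq_inner using \<alpha>_pos
    by (simp add: inner_simps inner_commute field_simps)
  then have "(norm (x - z))\<^sup>2 / \<alpha> - (norm (x' - z))\<^sup>2 / \<alpha> =
      (norm (x - xb))\<^sup>2 / \<alpha> - \<alpha> * (norm p)\<^sup>2 + 2 * ((1 / \<alpha>) *\<^sub>R (x - x') \<bullet> (xb - z))"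
    using \<alpha>_pos by simp
  moreover have "(l - m) \<bullet> Q (l - m) - (l' - m) \<bullet> Q (l' - m) =
      (l - l') \<bullet> Q (l - l') + 2 * ((l' - m) \<bullet> Q (l - l'))"
  proof -
    have "l - m = (l' - m) + (l - l')" by simp
    then have "Q (l - m) = Q (l' - m) + Q (l - l')" using linear_add[OF Q_linear] by metis
    moreover have "l \<bullet> y - m \<bullet> y = (l - l') \<bullet> y + (l' - m) \<bullet> y" for y
      by (simp add: inner_simps)
    moreover have "(l - l') \<bullet> Q (l' - m) = (l' - m) \<bullet> Q (l - l')" by (rule Q_sym)
    ultimately show ?thesis by (simp add: inner_simps)
  qed
  ultimately show ?thesis unfolding hsq_def inner_J p_def[symmetric] by linarith
qed

text \<open>The differences of two runs satisfy the same linear relations, so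
  \<open>three_point\<close> applies to them with z = m = 0. Monotonicity of the subgradients bounds
  the primal inner product, and its coupling term with A cancels against the dual one.\<close>

lemma step_nonexpansive:
  assumes "pd_step x l xb x' l'" "pd_step y m yb y' m'"
  shows "hsq (x' - y') (l' - m') + msq ((x - y) - (xb - yb)) ((l - m) - (l' - m'))
    \<le> hsq (x - y) (l - m)"
proof -
  define dx dxb dx' dl dl' dg where
    d: "dx = x - y" "dxb = xb - yb" "dx' = x' - y'" "dl = l - m" "dl' = l' - m'" "dg = gF x - gF y"
  have "((1 / \<alpha>) *\<^sub>R (x - x') - At l' - gF x - ((1 / \<alpha>) *\<^sub>R (y - y') - At m' - gF y)) \<bullet> (xb - yb) \<ge> 0"
    using assms unfolding pd_step_def by (intro subgrad_monotone) auto
  moreover have "(1 / \<alpha>) *\<^sub>R (x - x') - At l' - gF x - ((1 / \<alpha>) *\<^sub>R (y - y') - At m' - gF y)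
      = (1 / \<alpha>) *\<^sub>R (dx - dx') - At dl' - dg"
    by (simp add: d linear_diff[OF At_linear] algebra_simps)
  ultimately have "((1 / \<alpha>) *\<^sub>R (dx - dx')) \<bullet> dxb - At dl' \<bullet> dxb - dg \<bullet> dxb \<ge> 0"
    by (simp add: d inner_diff_left)
  moreover have "Q (dl - dl') = - A dxb"
  proof -
    have "Q (l' - l) = A xb - b" "Q (m' - m) = A yb - b" using assms by (auto simp: pd_step_def)
    then have "Q (l' - l) - Q (m' - m) = A xb - A yb" by simp
    then have "- Q (dl - dl') = A dxb"
      by (simp add: d linear_diff[OF Q_linear] linear_diff[OF A_linear] linear_add[OF Q_linear] algebra_simps)
    then show ?thesis by (metis minus_minus)
  qed
  moreover have "dx' = dxb + \<alpha> *\<^sub>R At (dl - dl')"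
  proof -
    have "At (dl - dl') = At (l - l') - At (m - m')"
      by (simp add: d linear_diff[OF At_linear])
    then show ?thesis
      using assms by (simp add: d(2,3) pd_step_def scaleR_diff_right)
  qed
  then have "hsq dx dl - hsq dx' dl' = (norm (dx - dxb))\<^sup>2 / \<alpha> + (dl - dl') \<bullet> J (dl - dl')
      + 2 * ((1 / \<alpha>) *\<^sub>R (dx - dx') \<bullet> dxb) + 2 * (dl' \<bullet> Q (dl - dl'))"
    using three_point[of dx' dxb dl dl' dx 0 0] by simp
  \<comment> \<open>Split dxb as dx - (dx - dxb), use cocoercivity on the first part and complete
    the square. The loss L/2 is exactly what lowers 1/\<alpha> to the primal weight in
    \<open>msq\<close>.\<close>
  moreover have "2 * (dg \<bullet> dxb) \<ge> - (L / 2 * (norm (dx - dxb))\<^sup>2)"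
  proof -
    have "dg \<bullet> dx \<ge> 1 / L * (norm dg)\<^sup>2" unfolding d by (rule cocoercive)
    moreover have "0 \<le> 2 / L * (norm (dg - (L / 2) *\<^sub>R (dx - dxb)))\<^sup>2" using L_pos by simp
    moreover have "2 / L * (norm (dg - (L / 2) *\<^sub>R (dx - dxb)))\<^sup>2 =
        2 / L * (norm dg)\<^sup>2 - 2 * (dg \<bullet> dx) + 2 * (dg \<bullet> dxb) + L / 2 * (norm (dx - dxb))\<^sup>2"
    proof -
      have "(norm (dg - c *\<^sub>R e))\<^sup>2 = (norm dg)\<^sup>2 - 2 * c * (dg \<bullet> e) + c\<^sup>2 * (norm e)\<^sup>2" for c e
        unfolding power2_norm_eq_inner
        by (simp add: inner_simps inner_commute power2_eq_square algebra_simps)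
      from this[of "L / 2" "dx - dxb"] show ?thesis using L_pos by (simp add: inner_diff_right field_simps power2_eq_square)
    qed
    ultimately show ?thesis by linarith
  qed
  ultimately show ?thesis
    unfolding msq_def d(1-5)[symmetric] by (simp add: inner_At algebra_simps)
qed

text \<open>Here z and m are arbitrary, so the subgradient inequality at xb replaces monotonicity,
  and F is compared at xb and z through its linearization at x. The Q term of
  \<open>three_point\<close> supplies the multiplier terms.\<close>

lemma step_gap:
  assumes step: "pd_step x l xb x' l'" and \<alpha>: "L \<le> 1 / \<alpha>" and J: "\<And>l. l \<bullet> J l \<ge> 0"
    and R: "R xb = ereal \<rho>" "R z = ereal \<sigma>"
  shows "F xb + \<rho> + m \<bullet> (A xb - b) - (F z + \<sigma> + l' \<bullet> (A z - b))
    \<le> (hsq (x - z) (l - m) - hsq (x' - z) (l' - m)) / 2"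
proof -
  let ?\<xi> = "(1 / \<alpha>) *\<^sub>R (x - x')"
  have "ereal \<rho> + ereal ((?\<xi> - At l' - gF x) \<bullet> (z - xb)) \<le> ereal \<sigma>"
    using step R unfolding pd_step_def subgrad_def by metis
  then have "\<rho> - \<sigma> \<le> (?\<xi> - At l' - gF x) \<bullet> (xb - z)" by (simp add: inner_diff_right)
  then have 1: "\<rho> - \<sigma> \<le> ?\<xi> \<bullet> (xb - z) - (l' \<bullet> A xb - l' \<bullet> A z) - gF x \<bullet> (xb - z)"
    by (simp only: inner_diff_left inner_At linear_diff[OF A_linear] inner_diff_right)
  have "F xb \<le> F x + gF x \<bullet> (xb - x) + L / 2 * (norm (xb - x))\<^sup>2"
    using upper_bound[of x "xb - x"] by simp
  moreover have "F x + gF x \<bullet> (z - x) \<le> F z" by (rule gradient_ineq)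
  ultimately have 2: "F xb - F z \<le> gF x \<bullet> (xb - z) + L / 2 * (norm (x - xb))\<^sup>2"
    by (simp add: inner_diff_right norm_minus_commute)
  have "Q (l - l') = - (A xb - b)"
    using step linear_diff[OF Q_linear] unfolding pd_step_def by (metis minus_diff_eq)
  then have 3: "(l' - m) \<bullet> Q (l - l') = m \<bullet> (A xb - b) - l' \<bullet> (A xb - b)"
    by (simp add: inner_diff_left inner_diff_right)
  have "x' = xb + \<alpha> *\<^sub>R At (l - l')" using step by (simp add: pd_step_def)
  note 4 = three_point[OF this, of x z m]
  \<comment> \<open>The linearization error, doubled, must fit under the full term with weight
    1/\<alpha>; this is where the ergodic bounds need the shorter step size.\<close>
  have "L * (norm (x - xb))\<^sup>2 \<le> 1 / \<alpha> * (norm (x - xb))\<^sup>2"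
    using \<alpha> by (rule mult_right_mono) simp
  then show ?thesis
    using 1 2 3 4 J[of "l - l'"] by (simp add: inner_diff_right)
qed

section \<open>Saddle points and the optimality conditions of the subproblems\<close>

definition saddle :: "'a \<Rightarrow> 'b \<Rightarrow> bool" where
  "saddle xs ls \<longleftrightarrow> (\<forall>x l.
    ereal (F xs) + R xs + ereal (l \<bullet> (A xs - b)) \<le> ereal (F xs) + R xs + ereal (ls \<bullet> (A xs - b)) \<and>
    ereal (F xs) + R xs + ereal (ls \<bullet> (A xs - b)) \<le> ereal (F x) + R x + ereal (ls \<bullet> (A x - b)))"

lemma R_not_MInf: "R x \<noteq> -\<infinity>" using R_proper by (simp add: proper_fun_def)

lemma saddle_finite:
  assumes "saddle xs ls" obtains \<sigma> where "R xs = ereal \<sigma>"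
proof -
  obtain y where "R y \<noteq> \<infinity>" using R_proper by (auto simp: proper_fun_def)
  then obtain t where "R y = ereal t" using R_not_MInf[of y] by (cases "R y") auto
  then have "ereal (F xs) + R xs + ereal (ls \<bullet> (A xs - b)) \<le> ereal (F y + t + ls \<bullet> (A y - b))"
    using assms unfolding saddle_def by (metis plus_ereal.simps(1))
  then show ?thesis using that R_not_MInf[of xs] by (cases "R xs") auto
qed

lemma saddle_feasible:
  assumes "saddle xs ls" shows "A xs = b"
proof -
  obtain \<sigma> where \<sigma>: "R xs = ereal \<sigma>" using saddle_finite[OF assms] .
  have "ereal (F xs) + R xs + ereal (l \<bullet> (A xs - b)) \<le> ereal (F xs) + R xs + ereal (ls \<bullet> (A xs - b))" for l
    using assms unfolding saddle_def by blast
  then have "l \<bullet> (A xs - b) \<le> ls \<bullet> (A xs - b)" for l by (simp add: \<sigma>)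
  \<comment> \<open>Raising the multiplier along the residual would raise the Lagrangian by the
    squared residual.\<close>
  from this[of "ls + (A xs - b)"] have "(A xs - b) \<bullet> (A xs - b) \<le> 0"
    by (simp add: inner_add_left)
  then show ?thesis by (metis eq_iff_diff_eq_0 inner_ge_zero inner_eq_zero_iff order_antisym)
qed

lemma saddle_lower_bound:
  assumes "saddle xs ls" "R xs = ereal \<sigma>" "R x = ereal \<rho>"
  shows "F xs + \<sigma> \<le> F x + \<rho> + ls \<bullet> (A x - b)"
proof -
  have "ereal (F xs) + R xs + ereal (ls \<bullet> (A xs - b)) \<le> ereal (F x) + R x + ereal (ls \<bullet> (A x - b))"
    using assms unfolding saddle_def by blast
  then show ?thesis using assms saddle_feasible[OF assms(1)] by simp
qed

text \<open>Minimality in the primal variable gives stationarity by Fermat's rule, and feasibility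
  handles the dual update. The constant sequence is thus a run with which others can be
  compared.\<close>

lemma saddle_fixed_point:
  assumes s: "saddle xs ls" shows "pd_step xs ls xs xs ls"
proof -
  have "subgrad R xs (- (At ls + gF xs))"
  proof (rule subgrad_of_minimizer[OF R_proper R_convex, where G = "\<lambda>x. F x + ls \<bullet> (A x - b)" and c = "L / 2"])
    show "R xs + ereal (F xs + ls \<bullet> (A xs - b)) \<le> R y + ereal (F y + ls \<bullet> (A y - b))" for y
    proof -
      have "ereal (F xs) + R xs + ereal (ls \<bullet> (A xs - b)) \<le> ereal (F y) + R y + ereal (ls \<bullet> (A y - b))"
        using s unfolding saddle_def by blast
      then show ?thesis by (metis add.assoc add.commute plus_ereal.simps(1))
    qed
    show "F y + ls \<bullet> (A y - b) \<le> F xs + ls \<bullet> (A xs - b) + (At ls + gF xs) \<bullet> (y - xs)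
        + L / 2 * (norm (y - xs))\<^sup>2" for y
      using upper_bound[of xs "y - xs"]
      by (simp add: inner_add_left inner_At linear_diff[OF A_linear] inner_diff_right)
  qed
  moreover have "(1 / \<alpha>) *\<^sub>R (xs - xs) - At ls - gF xs = - (At ls + gF xs)" by simp
  ultimately show ?thesis
    using saddle_feasible[OF s]
    unfolding pd_step_def by (simp add: linear_0[OF Q_linear] linear_0[OF At_linear])
qed

text \<open>Links the \<open>prox\<close> and \<open>arg_min\<close> form of the algorithm to
  \<open>pd_step\<close>.\<close>

lemma prox_step:
  assumes J_pos: "pos_def J"
    and xb: "xb = prox \<alpha> R (x - \<alpha> *\<^sub>R (At l + gF x))"
    and l': "l' = arg_min (\<lambda>m. 1/2 * norm_sq Q (m - l) + m \<bullet> (b - A xb)) (\<lambda>_. True)"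
    and x': "x' = xb + \<alpha> *\<^sub>R At (l - l')"
  shows "pd_step x l xb x' l'"
proof -
  \<comment> \<open>The Q form is the J form plus a nonnegative term, so Q is invertible and the
    dual subproblem has a unique solution.\<close>
  have Q_pos: "m \<bullet> Q m > 0" if "m \<noteq> 0" for m
    using that J_pos inner_J[of m] \<alpha>_pos unfolding pos_def_def
    by (smt (verit) mult_nonneg_nonneg zero_le_power2)
  have "inj Q"
    unfolding linear_injective_0[OF Q_linear] using Q_pos by force
  then obtain w where w: "Q w = A xb - b"
    using linear_injective_imp_surjective[OF Q_linear] by (metis surjD)
  define g where "g m = 1/2 * norm_sq Q (m - l) + m \<bullet> (b - A xb)" for m
  \<comment> \<open>Completing the square exactly around l + w makes the minimizer visible.\<close>
  have g: "g m = g (l + w) + 1/2 * ((m - (l + w)) \<bullet> Q (m - (l + w)))" for m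
  proof -
    define v where "v = m - (l + w)"
    have m: "m - l = w + v" "m = l + w + v" by (simp_all add: v_def)
    have "w \<bullet> Q v = v \<bullet> Q w" by (rule Q_sym)
    moreover have "y \<bullet> (b - A xb) = - (y \<bullet> Q w)" for y using w by (simp add: inner_diff_right)
    ultimately show ?thesis
      unfolding g_def norm_sq_def v_def[symmetric] m(1)
      by (subst m(2)) (simp add: linear_add[OF Q_linear] inner_add_left inner_add_right field_simps)
  qed
  have "arg_min g (\<lambda>_. True) = l + w"
  proof (rule arg_minI[where P = "\<lambda>_. True"])
    show "\<not> g m < g (l + w)" for m
      using g[of m] Q_pos[of "m - (l + w)"] by (cases "m = l + w") auto
    show "m = l + w" if "\<forall>y. True \<longrightarrow> \<not> g y < g m" for m
      using that[rule_format, of "l + w"] g[of m] Q_pos[of "m - (l + w)"] by (cases "m = l + w") auto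
  qed simp
  then have l'w: "l' = l + w" using l' by (simp add: g_def[abs_def])
  have "subgrad R xb ((1 / \<alpha>) *\<^sub>R ((x - \<alpha> *\<^sub>R (At l + gF x)) - xb))"
    unfolding xb by (rule prox_subgrad[OF R_proper R_closed R_convex \<alpha>_pos])
  moreover have "(1 / \<alpha>) *\<^sub>R ((x - \<alpha> *\<^sub>R (At l + gF x)) - xb) = (1 / \<alpha>) *\<^sub>R (x - x') - At l' - gF x"
    using \<alpha>_pos unfolding x' by (simp add: algebra_simps linear_diff[OF At_linear])
  ultimately show ?thesis
    unfolding pd_step_def using w x' by (simp add: l'w)
qed

end

subsection \<open>Rates along the iteration\<close>

lemma norm_add_sq_le: "(norm (x + y))\<^sup>2 \<le> 2 * (norm x)\<^sup>2 + 2 * (norm y)\<^sup>2" for x y :: "'a::real_inner"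
proof -
  have "0 \<le> (norm (x - y))\<^sup>2" by simp
  then show ?thesis by (simp add: power2_norm_eq_inner inner_simps inner_commute)
qed

section \<open>Averages and Jensen's inequality\<close>

lemma ergodic_mean_inner: "ergodic_mean K (\<lambda>k. u k \<bullet> v) = ergodic_mean K u \<bullet> v"
  by (simp add: ergodic_mean_def inner_sum_left)

lemma ergodic_mean_linear:
  assumes "linear A" shows "ergodic_mean K (\<lambda>k. A (u k)) = A (ergodic_mean K u)"
  by (simp add: ergodic_mean_def linear_cmul[OF assms] linear_sum[OF assms])

lemma ergodic_mean_const: "K \<ge> 1 \<Longrightarrow> ergodic_mean K (\<lambda>_. c) = c"
  by (simp add: ergodic_mean_def scaleR_conv_of_real sum_constant_scaleR)

lemma ergodic_mean_add: "ergodic_mean K (\<lambda>k. u k + v k) = ergodic_mean K u + ergodic_mean K v"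
  by (simp add: ergodic_mean_def sum.distrib scaleR_add_right)

lemma ergodic_mean_diff: "ergodic_mean K (\<lambda>k. u k - v k) = ergodic_mean K u - ergodic_mean K v"
  by (simp add: ergodic_mean_def sum_subtractf scaleR_diff_right)

lemma ergodic_mean_in_convex:
  assumes "convex S" "K \<ge> 1" "\<And>k. u k \<in> S"
  shows "ergodic_mean K u \<in> S"
proof -
  have "(\<Sum>k<K. (1 / real K) *\<^sub>R u k) \<in> S"
    using assms by (intro convex_sum) auto
  then show ?thesis by (simp add: ergodic_mean_def scaleR_sum_right)
qed

text \<open>Jensen's inequality, obtained by averaging points of the epigraph so that no arithmetic
  with infinite values arises.\<close>

lemma ergodic_mean_convex_fun:
  assumes "convex_fun R" "K \<ge> 1" "\<And>k. R (u k) \<le> ereal (\<rho> k)"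
  shows "R (ergodic_mean K u) \<le> ereal (ergodic_mean K \<rho>)"
proof -
  have "ergodic_mean K (\<lambda>k. (u k, \<rho> k)) \<in> ereal_epigraph R"
    using assms by (intro ergodic_mean_in_convex) (auto simp: convex_fun_def ereal_epigraph_def)
  moreover have "fst (ergodic_mean K (\<lambda>k. (u k, \<rho> k))) = ergodic_mean K u"
    "snd (ergodic_mean K (\<lambda>k. (u k, \<rho> k))) = ergodic_mean K \<rho>"
    by (simp_all add: ergodic_mean_def fst_sum snd_sum)
  ultimately show ?thesis by (auto simp: ereal_epigraph_def case_prod_unfold)
qed

lemma convex_on_ereal: "convex_on UNIV F \<Longrightarrow> convex_fun (\<lambda>x. ereal (F x))"
  using convex_epigraph[of UNIV F] by (simp add: convex_fun_def ereal_epigraph_def epigraph_def case_prod_unfold)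

section \<open>Residuals and increments of a run\<close>

locale pd_iteration = pd_problem F gF L R A b Q \<alpha>
  for F :: "'a::euclidean_space \<Rightarrow> real" and gF L R and A :: "'a \<Rightarrow> 'b::euclidean_space"
    and b Q \<alpha> +
  fixes X Xb :: "nat \<Rightarrow> 'a" and l :: "nat \<Rightarrow> 'b"
  assumes step: "\<And>k. pd_step (X k) (l k) (Xb k) (X (Suc k)) (l (Suc k))"
    and J_pos: "pos_def J"
begin

lemma J_nonneg: "m \<bullet> J m \<ge> 0"
  using J_pos linear_0[of J] by (cases "m = 0") (auto simp: pos_def_def self_adjoint_def less_imp_le)

lemma Q_ge_At: "\<alpha> * (norm (At m))\<^sup>2 \<le> m \<bullet> Q m"
  using J_nonneg[of m] by (simp add: inner_J)

lemma hsq_nonneg: "hsq x m \<ge> 0"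
proof -
  have "0 \<le> \<alpha> * (norm (At m))\<^sup>2" "(norm x)\<^sup>2 / \<alpha> \<ge> 0" using \<alpha>_pos by simp_all
  then show ?thesis using Q_ge_At[of m] by (simp add: hsq_def)
qed

lemma msq_nonneg: "L / 2 \<le> 1 / \<alpha> \<Longrightarrow> msq x m \<ge> 0"
  using J_nonneg[of m] by (simp add: msq_def)

abbreviation residual :: "nat \<Rightarrow> real" where
  "residual k \<equiv> msq (X k - Xb k) (l k - l (Suc k))"

abbreviation increment :: "nat \<Rightarrow> real" where
  "increment k \<equiv> hsq (X k - X (Suc k)) (l k - l (Suc k))"

lemma Xb_eq: "X k - Xb k = (X k - X (Suc k)) + \<alpha> *\<^sub>R At (l k - l (Suc k))"
  using step[of k] by (simp add: pd_step_def)

text \<open>The vector X - Xb differs from the primal increment by \<alpha> At w, whose weighted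
  square is controlled by the Q form of the dual increment w.\<close>

lemma residual_le_increment: "residual k \<le> 3 * increment k"
proof -
  define u w where uw: "u = X k - X (Suc k)" "w = l k - l (Suc k)"
  have "(1 / \<alpha> - L / 2) * (norm (X k - Xb k))\<^sup>2 \<le> 1 / \<alpha> * (norm (X k - Xb k))\<^sup>2"
    using L_pos by (intro mult_right_mono) auto
  also have "\<dots> \<le> 1 / \<alpha> * (2 * (norm u)\<^sup>2 + 2 * (norm (\<alpha> *\<^sub>R At w))\<^sup>2)"
    unfolding Xb_eq uw[symmetric] using \<alpha>_pos by (intro mult_left_mono norm_add_sq_le) auto
  also have "\<dots> = 2 * ((norm u)\<^sup>2 / \<alpha>) + 2 * (\<alpha> * (norm (At w))\<^sup>2)"
    using \<alpha>_pos by (simp add: power_mult_distrib field_simps power2_eq_square)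
  finally have *: "(1 / \<alpha> - L / 2) * (norm (X k - Xb k))\<^sup>2
      \<le> 2 * ((norm u)\<^sup>2 / \<alpha>) + 2 * (\<alpha> * (norm (At w))\<^sup>2)" .
  have "(norm u)\<^sup>2 / \<alpha> \<ge> 0" "\<alpha> * (norm (At w))\<^sup>2 \<ge> 0" using \<alpha>_pos by simp_all
  \<comment> \<open>In the application p and q are the primal and dual parts of the increment, a is
    the correction term and v the primal part of the residual.\<close>
  moreover have "v + (q - a) \<le> 3 * (p + q)"
    if "0 \<le> p" "0 \<le> a" "v \<le> 2 * p + 2 * a" "a \<le> q" for a p q v :: real
    using that by argo
  ultimately show ?thesis
    using * Q_ge_At[of w] unfolding msq_def hsq_def inner_J uw[symmetric] by blast
qed

text \<open>The converse comparison. Coercivity of J bounds the correction \<alpha> |At w|^2 by a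
  multiple \<kappa> of the J form, and the strict step size bound keeps the primal weight of the
  residual positive.\<close>

lemma increment_le_residual:
  assumes "L / 2 < 1 / \<alpha>"
  obtains C where "C \<ge> 0" "\<And>k. increment k \<le> C * residual k"
proof -
  obtain c where c: "c > 0" "\<And>m. c * (norm m)\<^sup>2 \<le> m \<bullet> J m"
    using pos_def_coercive[OF J_pos] by blast
  define N where "N = onorm At"
  define \<kappa> where "\<kappa> = \<alpha> * N\<^sup>2 / c"
  have At_bound: "\<alpha> * (norm (At m))\<^sup>2 \<le> \<kappa> * (m \<bullet> J m)" for m
  proof -
    have "norm (At m) \<le> N * norm m"
      unfolding N_def using At_linear by (intro onorm) (simp add: linear_linear)
    then have "(norm (At m))\<^sup>2 \<le> N\<^sup>2 * (norm m)\<^sup>2"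
      by (metis norm_ge_zero power_mono power_mult_distrib)
    also have "\<dots> \<le> N\<^sup>2 * ((m \<bullet> J m) / c)"
      using c by (intro mult_left_mono) (auto simp: field_simps)
    finally have "\<alpha> * (norm (At m))\<^sup>2 \<le> \<alpha> * (N\<^sup>2 * ((m \<bullet> J m) / c))"
      using \<alpha>_pos by (intro mult_left_mono) auto
    then show ?thesis by (simp add: \<kappa>_def)
  qed
  define C1 where "C1 = 2 / \<alpha> / (1 / \<alpha> - L / 2)"
  \<comment> \<open>One copy of the correction restores Q from J and two come from splitting the
    primal increment, hence 3 \<kappa>.\<close>
  define C2 where "C2 = 1 + 3 * \<kappa>"
  have nn: "C1 \<ge> 0" "C2 \<ge> 0" using \<alpha>_pos c assms by (auto simp: C1_def C2_def \<kappa>_def)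
  have "increment k \<le> (C1 + C2) * residual k" for k
  proof -
    define v w where vw: "v = X k - Xb k" "w = l k - l (Suc k)"
    have "X k - X (Suc k) = v + (- \<alpha>) *\<^sub>R At w" using Xb_eq[of k] by (simp add: vw)
    then have "(norm (X k - X (Suc k)))\<^sup>2 \<le> 2 * (norm v)\<^sup>2 + 2 * (norm ((- \<alpha>) *\<^sub>R At w))\<^sup>2"
      by (metis norm_add_sq_le)
    then have "(norm (X k - X (Suc k)))\<^sup>2 / \<alpha> \<le> (2 * (norm v)\<^sup>2 + 2 * (norm ((- \<alpha>) *\<^sub>R At w))\<^sup>2) / \<alpha>"
      using \<alpha>_pos by (simp add: divide_right_mono)
    also have "\<dots> = 2 / \<alpha> * (norm v)\<^sup>2 + 2 * (\<alpha> * (norm (At w))\<^sup>2)"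
      using \<alpha>_pos by (simp add: power_mult_distrib field_simps power2_eq_square)
    also have "2 / \<alpha> * (norm v)\<^sup>2 = C1 * ((1 / \<alpha> - L / 2) * (norm v)\<^sup>2)"
      unfolding C1_def using assms by simp
    finally have "(norm (X k - X (Suc k)))\<^sup>2 / \<alpha>
        \<le> C1 * ((1 / \<alpha> - L / 2) * (norm v)\<^sup>2) + 2 * (\<alpha> * (norm (At w))\<^sup>2)" .
    moreover have "C2 * (w \<bullet> J w) = w \<bullet> J w + 3 * (\<kappa> * (w \<bullet> J w))"
      by (simp add: C2_def algebra_simps)
    moreover have "p + q \<le> s + (j + 3 * y)"
      if "p \<le> s + 2 * a" "a \<le> y" "j = q - a" for a j p q s y :: real
      using that by linarith
    ultimately have "increment k \<le> C1 * ((1 / \<alpha> - L / 2) * (norm v)\<^sup>2) + C2 * (w \<bullet> J w)"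
      using At_bound[of w] inner_J[of w] unfolding hsq_def vw(2)[symmetric] by metis
    also have "\<dots> \<le> (C1 + C2) * ((1 / \<alpha> - L / 2) * (norm v)\<^sup>2) + (C1 + C2) * (w \<bullet> J w)"
      using nn J_nonneg[of w] assms by (intro add_mono mult_right_mono) auto
    finally show ?thesis unfolding msq_def vw[symmetric] by (simp add: algebra_simps)
  qed
  then show ?thesis using that[of "C1 + C2"] nn by simp
qed

lemma residual_descent:
  assumes "saddle xs ls"
  shows "hsq (X (Suc k) - xs) (l (Suc k) - ls) + residual k \<le> hsq (X k - xs) (l k - ls)"
  using step_nonexpansive[OF step saddle_fixed_point[OF assms]] by (simp add: algebra_simps)

lemma residual_sum_le:
  assumes "saddle xs ls"
  shows "(\<Sum>k<n. residual k) \<le> hsq (X 0 - xs) (l 0 - ls)"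
proof -
  have "(\<Sum>k<n. residual k) + hsq (X n - xs) (l n - ls) \<le> hsq (X 0 - xs) (l 0 - ls)"
  proof (induction n)
    case (Suc n)
    then show ?case using residual_descent[OF assms, of n] by simp
  qed simp
  then show ?thesis using hsq_nonneg[of "X n - xs" "l n - ls"] by linarith
qed

text \<open>Residuals are summable, but monotonicity is available for the increments. The rate is
  therefore proved for increments, which are summable by comparison, and transferred back.\<close>

lemma residual_small_o:
  assumes s: "saddle xs ls" and \<alpha>: "L / 2 < 1 / \<alpha>"
  shows "(\<lambda>k. real k * residual k) \<longlonglongrightarrow> 0"
proof -
  have nn: "residual k \<ge> 0" for k using \<alpha> by (intro msq_nonneg) simp
  have res_sum: "summable residual"
    using nn residual_sum_le[OF s] by (intro summableI_nonneg_bounded)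
  obtain C where C: "C \<ge> 0" "\<And>k. increment k \<le> C * residual k"
    using increment_le_residual[OF \<alpha>] by blast
  have "summable increment"
    using C hsq_nonneg by (intro summable_comparison_test'[OF summable_mult[OF res_sum, of C]]) simp
  \<comment> \<open>The increments are the distances between the run and its own shift by
    one.\<close>
  moreover have "decseq increment"
  proof (rule decseq_SucI)
    fix k
    have "increment (Suc k) + msq (X k - X (Suc k) - (Xb k - Xb (Suc k)))
        (l k - l (Suc k) - (l (Suc k) - l (Suc (Suc k)))) \<le> increment k"
      by (rule step_nonexpansive[OF step step])
    moreover have "msq (X k - X (Suc k) - (Xb k - Xb (Suc k)))
        (l k - l (Suc k) - (l (Suc k) - l (Suc (Suc k)))) \<ge> 0"
      using \<alpha> by (intro msq_nonneg) simp
    ultimately show "increment (Suc k) \<le> increment k" by linarith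
  qed
  ultimately have "(\<lambda>k. real k * increment k) \<longlonglongrightarrow> 0"
    by (intro decreasing_summable_small_o hsq_nonneg)
  then have lim: "(\<lambda>k. 3 * (real k * increment k)) \<longlonglongrightarrow> 0"
    by (rule tendsto_mult_right_zero)
  have "real k * residual k \<le> 3 * (real k * increment k)" for k
    using mult_left_mono[OF residual_le_increment[of k], of "real k"] by simp
  then show ?thesis
    using nn by (intro tendsto_sandwich[OF _ _ tendsto_const lim]) auto
qed

lemma min_residual_le:
  assumes s: "saddle xs ls"
  shows "Min (residual ` {0..K}) \<le> hsq (X 0 - xs) (l 0 - ls) / (real K + 1)"
proof -
  \<comment> \<open>The indices 0 to K give K + 1 terms, each at least the minimum.\<close>
  have "(real K + 1) * Min (residual ` {0..K}) = (\<Sum>k<Suc K. Min (residual ` {0..K}))"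
    by simp
  also have "\<dots> \<le> (\<Sum>k<Suc K. residual k)" by (intro sum_mono Min_le) auto
  also have "\<dots> \<le> hsq (X 0 - xs) (l 0 - ls)" by (rule residual_sum_le[OF s])
  finally show ?thesis by (simp add: field_simps)
qed

section \<open>Ergodic bounds\<close>

lemma R_Xb_finite: "R (Xb k) = ereal (real_of_ereal (R (Xb k)))"
  using step[of k] by (simp add: pd_step_def subgrad_def ereal_real')

lemma R_mean_le:
  assumes "K \<ge> 1"
  obtains \<rho> where "R (ergodic_mean K Xb) = ereal \<rho>"
    "\<rho> \<le> ergodic_mean K (\<lambda>k. real_of_ereal (R (Xb k)))"
proof -
  have "R (ergodic_mean K Xb) \<le> ereal (ergodic_mean K (\<lambda>k. real_of_ereal (R (Xb k))))"
    by (rule ergodic_mean_convex_fun[OF R_convex assms]) (use R_Xb_finite in auto)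
  then show ?thesis
    using that R_not_MInf[of "ergodic_mean K Xb"] by (cases "R (ergodic_mean K Xb)") auto
qed

text \<open>Averaging \<open>step_gap\<close> telescopes the right-hand side. On the left, Jensen
  handles F and R at Xb; everything else is affine in the averaged variables.\<close>

lemma ergodic_gap:
  assumes K: "K \<ge> 1" and \<alpha>: "L \<le> 1 / \<alpha>"
    and \<rho>: "R (ergodic_mean K Xb) = ereal \<rho>" and \<sigma>: "R z = ereal \<sigma>"
  shows "F (ergodic_mean K Xb) + \<rho> + m \<bullet> (A (ergodic_mean K Xb) - b)
      - (F z + \<sigma> + ergodic_mean K (\<lambda>k. l (Suc k)) \<bullet> (A z - b))
    \<le> hsq (X 0 - z) (l 0 - m) / (2 * real K)"
proof -
  let ?r = "\<lambda>k. real_of_ereal (R (Xb k))"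
  define h where "h k = hsq (X k - z) (l k - m)" for k
  \<comment> \<open>The multiplier m stands on the right of the inner product so that
    \<open>ergodic_mean_inner\<close> applies.\<close>
  define g where "g k = F (Xb k) + ?r k + (A (Xb k) - b) \<bullet> m
      - (F z + \<sigma> + l (Suc k) \<bullet> (A z - b))" for k
  have "g k \<le> (h k - h (Suc k)) / 2" for k
    unfolding g_def h_def
    using step_gap[OF step \<alpha> J_nonneg R_Xb_finite \<sigma>, of k m] by (simp add: inner_commute)
  then have "(\<Sum>k<K. g k) \<le> (\<Sum>k<K. (h k - h (Suc k)) / 2)" by (rule sum_mono)
  also have "\<dots> = (h 0 - h K) / 2" by (simp add: sum_divide_distrib[symmetric] sum_lessThan_telescope')
  also have "\<dots> \<le> h 0 / 2" using hsq_nonneg by (simp add: h_def)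
  finally have "ergodic_mean K g \<le> h 0 / (2 * real K)"
    using K by (simp add: ergodic_mean_def field_simps)
  moreover have "ergodic_mean K g = ergodic_mean K (\<lambda>k. F (Xb k)) + ergodic_mean K ?r
      + (A (ergodic_mean K Xb) - b) \<bullet> m
      - (F z + \<sigma> + ergodic_mean K (\<lambda>k. l (Suc k)) \<bullet> (A z - b))"
    unfolding g_def
    by (simp only: ergodic_mean_add ergodic_mean_diff ergodic_mean_inner
        ergodic_mean_linear[OF A_linear] ergodic_mean_const[OF K])
  moreover have "F (ergodic_mean K Xb) \<le> ergodic_mean K (\<lambda>k. F (Xb k))"
    using ergodic_mean_convex_fun[OF convex_on_ereal[OF convex] K, of Xb "\<lambda>k. F (Xb k)"] by simp
  moreover have "\<rho> \<le> ergodic_mean K ?r"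
    using R_mean_le[OF K] \<rho> by (metis ereal.inject)
  ultimately show ?thesis unfolding h_def by (simp add: inner_commute)
qed

lemma Lagrangian_gap:
  assumes K: "K \<ge> 1" and \<alpha>: "L \<le> 1 / \<alpha>"
  shows "ereal (F (ergodic_mean K Xb)) + R (ergodic_mean K Xb)
        + ereal (m \<bullet> (A (ergodic_mean K Xb) - b))
      - (ereal (F z) + R z + ereal (ergodic_mean K (\<lambda>k. l (Suc k)) \<bullet> (A z - b)))
    \<le> ereal (hsq (X 0 - z) (l 0 - m) / (2 * real K))"
proof -
  obtain \<rho> where \<rho>: "R (ergodic_mean K Xb) = ereal \<rho>" using R_mean_le[OF K] by metis
  show ?thesis
  proof (cases "R z")
    case (real \<sigma>)
    then show ?thesis using ergodic_gap[OF K \<alpha> \<rho> real, of m] by (simp add: \<rho>)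
  next
    \<comment> \<open>A finite value minus infinity is minus infinity, so the bound is
      trivial.\<close>
    case PInf
    then show ?thesis by (simp add: \<rho>)
  qed (use R_not_MInf in auto)
qed

text \<open>Testing with a multiplier of length t along the residual e adds t |e| to the objective
  gap, while the saddle point bounds that gap below by -|ls| |e|. Hence (t - |ls|) |e| is at most C.
  The two entries of the maximum make t - |ls| at least 1, for feasibility, and at least |ls|, for
  the lower objective bound.\<close>

lemma ergodic_error_bounds:
  assumes K: "K \<ge> 1" and \<alpha>: "L \<le> 1 / \<alpha>" and l0: "l 0 = 0"
    and s: "saddle xs ls" and t: "t = max (1 + norm ls) (2 * norm ls)"
    and \<rho>: "R (ergodic_mean K Xb) = ereal \<rho>" and \<sigma>: "R xs = ereal \<sigma>"
    and C: "C = (1 / \<alpha> * (norm (X 0 - xs))\<^sup>2 + t\<^sup>2 * onorm Q) / (2 * real K)"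
  shows "\<bar>(F (ergodic_mean K Xb) + \<rho>) - (F xs + \<sigma>)\<bar> \<le> C"
    and "norm (A (ergodic_mean K Xb) - b) \<le> C"
proof -
  let ?x = "ergodic_mean K Xb"
  define e where "e = A ?x - b"
  \<comment> \<open>Since \<open>sgn 0 = 0\<close>, this also covers a vanishing residual, and the
    norm of m is at most t.\<close>
  define m where "m = t *\<^sub>R sgn e"
  have t0: "t \<ge> 0" "1 \<le> t - norm ls" "norm ls \<le> t - norm ls" unfolding t using norm_ge_zero[of ls] by linarith+
  have me: "m \<bullet> e = t * norm e"
    by (cases "e = 0") (simp_all add: m_def sgn_div_norm power2_norm_eq_inner[symmetric] power2_eq_square)
  have bl: "bounded_linear Q" using Q_linear by (simp add: linear_linear)
  have "norm m \<le> t" using t0 by (simp add: m_def norm_sgn)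
  have "m \<bullet> Q m \<le> norm m * norm (Q m)" by (rule norm_cauchy_schwarz)
  also have "\<dots> \<le> norm m * (onorm Q * norm m)" by (intro mult_left_mono onorm[OF bl]) auto
  also have "\<dots> = (norm m)\<^sup>2 * onorm Q" by (simp add: power2_eq_square)
  also have "\<dots> \<le> t\<^sup>2 * onorm Q"
    using \<open>norm m \<le> t\<close> by (intro mult_right_mono power_mono onorm_pos_le[OF bl]) auto
  finally have "hsq (X 0 - xs) (l 0 - m) \<le> 1 / \<alpha> * (norm (X 0 - xs))\<^sup>2 + t\<^sup>2 * onorm Q"
    unfolding hsq_def l0 by (simp add: linear_neg[OF Q_linear])
  then have "hsq (X 0 - xs) (l 0 - m) / (2 * real K) \<le> C"
    unfolding C by (rule divide_right_mono) simp
  moreover note ergodic_gap[OF K \<alpha> \<rho> \<sigma>, of m]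
  ultimately have upper: "(F ?x + \<rho>) - (F xs + \<sigma>) + t * norm e \<le> C"
    using saddle_feasible[OF s] me by (simp add: e_def[symmetric])
  have "ls \<bullet> e \<le> norm ls * norm e" by (rule norm_cauchy_schwarz)
  then have lower: "- (norm ls * norm e) \<le> (F ?x + \<rho>) - (F xs + \<sigma>)"
    using saddle_lower_bound[OF s \<sigma> \<rho>] by (simp add: e_def)
  have "1 * norm e \<le> (t - norm ls) * norm e" "norm ls * norm e \<le> (t - norm ls) * norm e"
    using t0 by (intro mult_right_mono; simp)+
  moreover have "(t - norm ls) * norm e \<le> C" using upper lower by (simp add: left_diff_distrib)
  moreover have "0 \<le> t * norm e" using t0 by simp
  ultimately show "\<bar>(F ?x + \<rho>) - (F xs + \<sigma>)\<bar> \<le> C" and "norm (A ?x - b) \<le> C"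
    using upper lower unfolding e_def[symmetric] by linarith+
qed

end

subsection \<open>The composite problem\<close>

lemma GDERIV_F_ext:
  fixes f :: "real^'n \<Rightarrow> real" and X :: "(real^'n) \<times> (real^'p)"
  assumes "f differentiable (at (fst X))"
  shows "GDERIV (F_ext f) X :> (gradient f (fst X), 0)"
proof -
  have "(f has_derivative (\<lambda>h. h \<bullet> gradient f (fst X))) (at (fst X))"
    using GDERIV_gradient[OF assms] by (simp add: gderiv_def)
  moreover have "(fst has_derivative fst) (at X)"
    by (intro has_derivative_fst has_derivative_ident)
  ultimately have "((\<lambda>X. f (fst X)) has_derivative (\<lambda>h. fst h \<bullet> gradient f (fst X))) (at X)"
    by (rule has_derivative_compose[rotated])
  then show ?thesis by (simp add: gderiv_def F_ext_def[abs_def] inner_prod_def)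
qed

text \<open>The lifted gradient is zero in the second block and the first projection does not
  increase distances, so L is unchanged.\<close>

lemma smooth_convex_F_ext:
  fixes f :: "real^'n \<Rightarrow> real"
  assumes "L > 0" "convex_on UNIV f" "\<forall>x. f differentiable (at x)"
    and lip: "L-lipschitz_on UNIV (gradient f)"
  shows "smooth_convex_fun (F_ext f :: (real^'n) \<times> (real^'p) \<Rightarrow> real) (gradient (F_ext f)) L"
proof
  have g: "GDERIV (F_ext f) X :> (gradient f (fst X), 0)" for X :: "(real^'n) \<times> (real^'p)"
    using assms by (intro GDERIV_F_ext) auto
  then have grad: "gradient (F_ext f) X = (gradient f (fst X), 0)" for X :: "(real^'n) \<times> (real^'p)"
    by (rule gradient_eqI)
  show "GDERIV (F_ext f) X :> gradient (F_ext f) X" for X :: "(real^'n) \<times> (real^'p)"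
    using g by (simp add: grad)
  show "L-lipschitz_on UNIV (gradient (F_ext f) :: (real^'n) \<times> (real^'p) \<Rightarrow> _)"
  proof (rule lipschitz_onI)
    fix X Y :: "(real^'n) \<times> (real^'p)"
    have "dist (gradient f (fst X)) (gradient f (fst Y)) \<le> L * dist (fst X) (fst Y)"
      using lip by (rule lipschitz_onD) auto
    also have "\<dots> \<le> L * dist X Y" using \<open>L > 0\<close> by (intro mult_left_mono dist_fst_le) auto
    finally show "dist (gradient (F_ext f) X) (gradient (F_ext f) Y) \<le> L * dist X Y"
      by (simp add: grad dist_Pair_Pair)
  qed (use \<open>L > 0\<close> in auto)
  show "convex_on UNIV (F_ext f :: (real^'n) \<times> (real^'p) \<Rightarrow> real)"
    using assms(2) by (auto simp: convex_on_def F_ext_def)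
qed fact

text \<open>As a preimage under a continuous linear map, the lifted epigraph inherits closedness and
  convexity.\<close>

lemma epigraph_R_ext:
  "ereal_epigraph (R_ext r) = (\<lambda>z. (snd (fst z), snd z)) -` ereal_epigraph r"
  by (auto simp: ereal_epigraph_def R_ext_def)

lemma closed_R_ext:
  assumes "closed_fun r" shows "closed_fun (R_ext r)"
  unfolding closed_fun_def epigraph_R_ext
  using assms by (intro continuous_closed_vimage) (auto simp: closed_fun_def intro!: continuous_intros)

lemma convex_R_ext:
  assumes "convex_fun r" shows "convex_fun (R_ext r)"
  unfolding convex_fun_def epigraph_R_ext
  using assms by (intro convex_linear_vimage) (auto simp: convex_fun_def intro!: linearI)

lemma proper_R_ext:
  assumes "proper_fun r" shows "proper_fun (R_ext r)"
  using assms by (auto simp: proper_fun_def R_ext_def)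

lemma linear_D_ext: "linear (D_ext B D)"
  by (intro linearI)
    (auto simp: D_ext_def matrix_vector_right_distrib matrix_vector_mult_scaleR algebra_simps)

theorem theorem2:
  fixes f :: "real^'n \<Rightarrow> real" and L :: real
    and r :: "real^'p1 \<Rightarrow> ereal"
    and B :: "real^'n^'p1" and D :: "real^'n^'p2" and d :: "real^'p2"
    and Q :: "(real^'p2) \<times> (real^'p1) \<Rightarrow> (real^'p2) \<times> (real^'p1)"
    and \<alpha> :: real
    and X Xbar :: "nat \<Rightarrow> (real^'n) \<times> (real^'p1)"
    and \<Lambda> :: "nat \<Rightarrow> (real^'p2) \<times> (real^'p1)"
    and W V :: "nat \<Rightarrow> ((real^'n) \<times> (real^'p1)) \<times> ((real^'p2) \<times> (real^'p1))"
  assumes L_pos: "L > 0"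
    and f_convex: "convex_on UNIV f"
    and f_diff: "\<forall>x. f differentiable (at x)"
    and f_grad_lipschitz: "L-lipschitz_on UNIV (gradient f)"
    and r_proper: "proper_fun r" and r_closed: "closed_fun r" and r_convex: "convex_fun r"
    and solvable: "solution_set f r B D d \<noteq> {}"
    and strong_duality: "saddle_points f r B D d \<noteq> {}"
    and Q_self_adjoint: "self_adjoint Q"
    and Lambda_0: "\<Lambda> 0 = 0"
    and Xbar_step: "\<And>k. Xbar k = prox \<alpha> (R_ext r)
          (X k - \<alpha> *\<^sub>R (adjoint (D_ext B D) (\<Lambda> k) + gradient (F_ext f) (X k)))"
    and Lambda_step: "\<And>k. \<Lambda> (Suc k) = arg_min
          (\<lambda>M. 1/2 * norm_sq Q (M - \<Lambda> k) + M \<bullet> (d_ext d - D_ext B D (Xbar k))) (\<lambda>_. True)"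
    and X_step: "\<And>k. X (Suc k) = Xbar k + \<alpha> *\<^sub>R adjoint (D_ext B D) (\<Lambda> k - \<Lambda> (Suc k))"
    and W_def: "\<And>k. W k = (X k, \<Lambda> k)"
    and V_def: "\<And>k. V (Suc k) = (Xbar k, \<Lambda> (Suc k))"
  shows "(\<alpha> \<in> {0<..<2/L} \<and> pos_def (J_op \<alpha> B D Q) \<longrightarrow>
           (\<forall>Ws \<in> saddle_points f r B D d.
              (\<lambda>k. real k * norm_sq (M_op \<alpha> L B D Q) (V (Suc k) - W k)) \<longlonglongrightarrow> 0 \<and>
              (\<forall>K. Min ((\<lambda>k. norm_sq (M_op \<alpha> L B D Q) (V (Suc k) - W k)) ` {0..K})
                     \<le> norm_sq (H_op \<alpha> Q) (W 0 - Ws) / (real K + 1))))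
       \<and> (\<alpha> \<in> {0<..<1/L} \<and> pos_def (J_op \<alpha> B D Q) \<longrightarrow>
           (\<forall>K\<ge>1.
              (\<forall>X' \<Lambda>'.
                 Lagrangian f r B D d (ergodic_mean K Xbar) \<Lambda>'
                   - Lagrangian f r B D d X' (ergodic_mean K (\<lambda>k. \<Lambda> (Suc k)))
                 \<le> ereal (norm_sq (H_op \<alpha> Q) (W 0 - (X', \<Lambda>')) / (2 * real K))) \<and>
              (\<forall>(Xs, \<Lambda>s) \<in> saddle_points f r B D d.
                 \<forall>\<rho>. \<rho> = max (1 + norm \<Lambda>s) (2 * norm \<Lambda>s) \<longrightarrow>
                   \<bar>Phi f r (ergodic_mean K Xbar) - Phi f r Xs\<bar>
                     \<le> ereal ((1 / \<alpha> * (norm (X 0 - Xs))\<^sup>2 + \<rho>\<^sup>2 * onorm Q) / (2 * real K)) \<and>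
                   norm (D_ext B D (ergodic_mean K Xbar) - d_ext d)
                     \<le> (1 / \<alpha> * (norm (X 0 - Xs))\<^sup>2 + \<rho>\<^sup>2 * onorm Q) / (2 * real K))))"
proof -
  \<comment> \<open>The step size and J conditions belong to the separate claims, so the locale
    instance is established conditionally and interpreted within each part.\<close>
  have iter: "pd_iteration (F_ext f) (gradient (F_ext f)) L (R_ext r) (D_ext B D) (d_ext d) Q \<alpha> X Xbar \<Lambda>"
    and J_eq: "pd_problem.J (D_ext B D) Q \<alpha> = J_op \<alpha> B D Q"
    if \<alpha>: "\<alpha> > 0" and J: "pos_def (J_op \<alpha> B D Q)"
  proof -
    interpret P: smooth_convex_fun "F_ext f :: (real^'n) \<times> (real^'p1) \<Rightarrow> real" "gradient (F_ext f)" L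
      using L_pos f_convex f_diff f_grad_lipschitz by (rule smooth_convex_F_ext)
    interpret P: pd_problem "F_ext f" "gradient (F_ext f)" L "R_ext r" "D_ext B D" "d_ext d" Q \<alpha>
      using \<alpha> r_proper r_closed r_convex Q_self_adjoint
      by unfold_locales (simp_all add: proper_R_ext closed_R_ext convex_R_ext 
          linear_add[OF linear_D_ext] linear_cmul[OF linear_D_ext])
    show J_eq: "P.J = J_op \<alpha> B D Q" by (simp add: fun_eq_iff P.J_def J_op_def)
    show "pd_iteration (F_ext f) (gradient (F_ext f)) L (R_ext r) (D_ext B D) (d_ext d) Q \<alpha> X Xbar \<Lambda>"
      using P.prox_step[OF _ Xbar_step Lambda_step X_step] J
      by unfold_locales (simp_all add: J_eq)
  qed
  have part1: "(\<lambda>k. real k * norm_sq (M_op \<alpha> L B D Q) (V (Suc k) - W k)) \<longlonglongrightarrow> 0"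
    "Min ((\<lambda>k. norm_sq (M_op \<alpha> L B D Q) (V (Suc k) - W k)) ` {0..K})
       \<le> norm_sq (H_op \<alpha> Q) (W 0 - Ws) / (real K + 1)"
    if \<alpha>: "\<alpha> \<in> {0<..<2/L}" and J: "pos_def (J_op \<alpha> B D Q)" and Ws: "Ws \<in> saddle_points f r B D d"
    for Ws K
  proof -
    have \<alpha>0: "\<alpha> > 0" and \<alpha>L: "L / 2 < 1 / \<alpha>" using \<alpha> L_pos by (auto simp: field_simps)
    interpret I: pd_iteration "F_ext f" "gradient (F_ext f)" L "R_ext r" "D_ext B D" "d_ext d" Q \<alpha> X Xbar \<Lambda>
      by (rule iter[OF \<alpha>0 J])
    obtain Xs \<Lambda>s where Ws_eq: "Ws = (Xs, \<Lambda>s)" by (cases Ws)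
    have s: "I.saddle Xs \<Lambda>s"
      using Ws by (simp add: Ws_eq saddle_points_def I.saddle_def Lagrangian_def)
    \<comment> \<open>The theorem measures V - W, while \<open>residual\<close> uses the opposite
      sign; \<open>I.msq_minus\<close> reconciles them.\<close>
    have M: "norm_sq (M_op \<alpha> L B D Q) (V (Suc k) - W k) = I.residual k" for k
      unfolding I.msq_minus[of "X k"]
      by (simp add: V_def W_def norm_sq_def M_op_def inner_prod_def I.msq_def power2_norm_eq_inner
          J_eq[OF \<alpha>0 J] distrib_left)
    have H: "norm_sq (H_op \<alpha> Q) (W 0 - Ws) = I.hsq (X 0 - Xs) (\<Lambda> 0 - \<Lambda>s)"
      by (simp add: W_def Ws_eq norm_sq_def H_op_def inner_prod_def I.hsq_def power2_norm_eq_inner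
          add_divide_distrib)
    show "(\<lambda>k. real k * norm_sq (M_op \<alpha> L B D Q) (V (Suc k) - W k)) \<longlonglongrightarrow> 0"
      unfolding M by (rule I.residual_small_o[OF s \<alpha>L])
    show "Min ((\<lambda>k. norm_sq (M_op \<alpha> L B D Q) (V (Suc k) - W k)) ` {0..K})
       \<le> norm_sq (H_op \<alpha> Q) (W 0 - Ws) / (real K + 1)"
      unfolding M H by (rule I.min_residual_le[OF s])
  qed
  have part2: "Lagrangian f r B D d (ergodic_mean K Xbar) \<Lambda>'
        - Lagrangian f r B D d X' (ergodic_mean K (\<lambda>k. \<Lambda> (Suc k)))
      \<le> ereal (norm_sq (H_op \<alpha> Q) (W 0 - (X', \<Lambda>')) / (2 * real K))"
    and part3: "(Xs, \<Lambda>s) \<in> saddle_points f r B D d \<Longrightarrow> \<rho> = max (1 + norm \<Lambda>s) (2 * norm \<Lambda>s) \<Longrightarrow>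
       \<bar>Phi f r (ergodic_mean K Xbar) - Phi f r Xs\<bar>
         \<le> ereal ((1 / \<alpha> * (norm (X 0 - Xs))\<^sup>2 + \<rho>\<^sup>2 * onorm Q) / (2 * real K)) \<and>
       norm (D_ext B D (ergodic_mean K Xbar) - d_ext d)
         \<le> (1 / \<alpha> * (norm (X 0 - Xs))\<^sup>2 + \<rho>\<^sup>2 * onorm Q) / (2 * real K)"
    if \<alpha>: "\<alpha> \<in> {0<..<1/L}" and J: "pos_def (J_op \<alpha> B D Q)" and K: "K \<ge> 1"
    for K X' \<Lambda>' Xs \<Lambda>s \<rho>
  proof -
    have \<alpha>0: "\<alpha> > 0" and \<alpha>L: "L \<le> 1 / \<alpha>" using \<alpha> L_pos by (auto simp: field_simps)
    interpret I: pd_iteration "F_ext f" "gradient (F_ext f)" L "R_ext r" "D_ext B D" "d_ext d" Q \<alpha> X Xbar \<Lambda>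
      by (rule iter[OF \<alpha>0 J])
    have H: "norm_sq (H_op \<alpha> Q) (W 0 - (X', \<Lambda>')) = I.hsq (X 0 - X') (\<Lambda> 0 - \<Lambda>')"
      by (simp add: W_def norm_sq_def H_op_def inner_prod_def I.hsq_def power2_norm_eq_inner
          add_divide_distrib)
    show "Lagrangian f r B D d (ergodic_mean K Xbar) \<Lambda>'
        - Lagrangian f r B D d X' (ergodic_mean K (\<lambda>k. \<Lambda> (Suc k)))
      \<le> ereal (norm_sq (H_op \<alpha> Q) (W 0 - (X', \<Lambda>')) / (2 * real K))"
      unfolding Lagrangian_def H by (rule I.Lagrangian_gap[OF K \<alpha>L])
    assume "(Xs, \<Lambda>s) \<in> saddle_points f r B D d" and \<rho>: "\<rho> = max (1 + norm \<Lambda>s) (2 * norm \<Lambda>s)"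
    then have s: "I.saddle Xs \<Lambda>s"
      by (simp add: saddle_points_def I.saddle_def Lagrangian_def)
    obtain t where t: "R_ext r (ergodic_mean K Xbar) = ereal t" using I.R_mean_le[OF K] by metis
    obtain \<sigma> where \<sigma>: "R_ext r Xs = ereal \<sigma>" using I.saddle_finite[OF s] .
    show "\<bar>Phi f r (ergodic_mean K Xbar) - Phi f r Xs\<bar>
         \<le> ereal ((1 / \<alpha> * (norm (X 0 - Xs))\<^sup>2 + \<rho>\<^sup>2 * onorm Q) / (2 * real K)) \<and>
       norm (D_ext B D (ergodic_mean K Xbar) - d_ext d)
         \<le> (1 / \<alpha> * (norm (X 0 - Xs))\<^sup>2 + \<rho>\<^sup>2 * onorm Q) / (2 * real K)"
      using I.ergodic_error_bounds[OF K \<alpha>L Lambda_0 s \<rho> t \<sigma> refl] by (simp add: Phi_def t \<sigma>)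
  qed
  show ?thesis using part1 part2 part3 by blast
qed

end
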